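(* Let $d>0$. (1) There exists a partition of $(0,\infty)^2\setminus\{L\}$ into two dense sets $A$ and $B$, each of them a union of invariant curves $\mathcal C_K^+$ ($K>K_m$), such that every point of $A$ is periodic under $F$ and every point of $B$ has an orbit under $F$ which is dense in the curve $\mathcal C_K^+$ passing through it. (2) There exists an integer $N(d)$ such that every integer $q\geq N(d)$ is the minimal period of some solution $(u_n,v_n)$ in $(0,\infty)^2$ of the system $$u_{n+1}u_n=1+\frac{d}{v_n},\qquad v_{n+1}v_n=1+\frac{d}{u_{n+1}}.$$
   Context: Fix $d>0$. The map $F:(0,\infty)^2\to(0,\infty)^2$ is $F(x,y)=\Big(\frac{y+d}{xy},\ \frac{dxy+y+d}{y(y+d)}\Big)$, so that the solutions of the system are exactly the sequences $(u_n,v_n)=F^n(u_0,v_0)$. It leaves invariant the function $G(x,y)=x+y+\frac1x+\frac1y+\frac{d}{xy}$. Let $\ell>0$ be the unique positive solution of $t^3-t-d=0$, $L=(\ell,\ell)$ (the unique fixed point of $F$) and $K_m=3\ell+\frac1\ell=G(L)$, the minimum of $G$. For $K>K_m$, $\mathcal C_K^+=\{(x,y)\in(0,\infty)^2: G(x,y)=K\}$, the positive part of the cubic $xy(x+y)+(x+y)+d-Kxy=0$. *)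

theory Defs
  imports "HOL-Analysis.Analysis"
begin

definition quadrant :: "(real \<times> real) set" where
  "quadrant = {0<..} \<times> {0<..}"

text \<open>Only the values for \<open>d > 0\<close> on \<open>quadrant\<close> are meaningful for the functions below.\<close>

definition F :: "real \<Rightarrow> real \<times> real \<Rightarrow> real \<times> real" where
  "F d = (\<lambda>(x, y). ((y + d) / (x * y), (d * x * y + y + d) / (y * (y + d))))"

definition G :: "real \<Rightarrow> real \<times> real \<Rightarrow> real" where
  "G d = (\<lambda>(x, y). x + y + 1 / x + 1 / y + d / (x * y))"

definition ell :: "real \<Rightarrow> real" where
  "ell d = (THE t. t > 0 \<and> t ^ 3 - t - d = 0)"

definition L :: "real \<Rightarrow> real \<times> real" where
  "L d = (ell d, ell d)"

definition K_min :: "real \<Rightarrow> real" where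
  "K_min d = 3 * ell d + 1 / ell d"

definition curve :: "real \<Rightarrow> real \<Rightarrow> (real \<times> real) set" where
  "curve d K = {p \<in> quadrant. G d p = K}"

definition periodic_point :: "('a \<Rightarrow> 'a) \<Rightarrow> 'a \<Rightarrow> bool" where
  "periodic_point f p \<longleftrightarrow> (\<exists>n>0. (f ^^ n) p = p)"

definition forward_orbit :: "('a \<Rightarrow> 'a) \<Rightarrow> 'a \<Rightarrow> 'a set" where
  "forward_orbit f p = {(f ^^ n) p | n. True}"

definition dense_subset :: "'a::topological_space set \<Rightarrow> 'a set \<Rightarrow> bool" where
  "dense_subset A S \<longleftrightarrow> A \<subseteq> S \<and> S \<subseteq> closure A"

definition union_of_curves :: "real \<Rightarrow> (real \<times> real) set \<Rightarrow> bool" where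
  "union_of_curves d A \<longleftrightarrow> (\<exists>\<K>. \<K> \<subseteq> {K_min d<..} \<and> A = (\<Union>K\<in>\<K>. curve d K))"

definition positive_solution :: "real \<Rightarrow> (nat \<Rightarrow> real) \<Rightarrow> (nat \<Rightarrow> real) \<Rightarrow> bool" where
  "positive_solution d u v \<longleftrightarrow>
     (\<forall>n. u n > 0 \<and> v n > 0) \<and>
     (\<forall>n. u (Suc n) * u n = 1 + d / v n \<and> v (Suc n) * v n = 1 + d / u (Suc n))"

definition seq_period :: "(nat \<Rightarrow> 'a) \<Rightarrow> nat \<Rightarrow> bool" where
  "seq_period w q \<longleftrightarrow> q > 0 \<and> (\<forall>n. w (n + q) = w n)"

definition minimal_seq_period :: "(nat \<Rightarrow> 'a) \<Rightarrow> nat \<Rightarrow> bool" where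
  "minimal_seq_period w q \<longleftrightarrow> seq_period w q \<and> (\<forall>r. seq_period w r \<longrightarrow> q \<le> r)"

lemma ell_ex1:
  assumes "d > 0"
  shows "\<exists>!t::real. t > 0 \<and> t ^ 3 - t - d = 0"
proof (rule ex_ex1I)
  let ?p = "\<lambda>t::real. t ^ 3 - t - d"
  have "?p (1 + d) = 2 * d + 3 * d ^ 2 + d ^ 3 - d"
    by (simp add: algebra_simps power2_eq_square power3_eq_cube)
  then have "0 \<le> ?p (1 + d)"
    using assms by (simp add: add_nonneg_nonneg)
  then have "\<exists>t. 0 \<le> t \<and> t \<le> 1 + d \<and> ?p t = 0"
    using assms by (intro IVT') (auto intro!: continuous_intros)
  then obtain t where t: "0 \<le> t" "?p t = 0" by blast
  then have "t \<noteq> 0" using assms by auto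
  with t show "\<exists>t. t > 0 \<and> ?p t = 0" by (intro exI[of _ t]) auto
next
  have aux: "\<not> s < t"
    if "s > 0" "s ^ 3 - s - d = 0" "t > 0" "t ^ 3 - t - d = 0" for s t :: real
  proof
    assume "s < t"
    have "s * (s\<^sup>2 - 1) = d" "t * (t\<^sup>2 - 1) = d"
      using that by (auto simp: algebra_simps power2_eq_square power3_eq_cube)
    moreover have "s\<^sup>2 - 1 > 0"
      using calculation(1) assms \<open>s > 0\<close> by (metis zero_less_mult_pos)
    moreover have "s\<^sup>2 < t\<^sup>2"
      using \<open>s < t\<close> \<open>s > 0\<close> by (simp add: power_strict_mono)
    moreover have "s * (s\<^sup>2 - 1) < t * (t\<^sup>2 - 1)"
      using calculation \<open>s < t\<close> \<open>s > 0\<close> by (intro mult_strict_mono) auto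
    ultimately show False by simp
  qed
  fix s t :: real
  assume "s > 0 \<and> s ^ 3 - s - d = 0" "t > 0 \<and> t ^ 3 - t - d = 0"
  then show "s = t" using aux[of s t] aux[of t s] by linarith
qed

lemma F_quadrant:
  assumes "d > 0" "p \<in> quadrant"
  shows "F d p \<in> quadrant"
  using assms by (auto simp: F_def quadrant_def intro!: divide_pos_pos add_pos_pos)

lemma G_F:
  assumes "d > 0" "p \<in> quadrant"
  shows "G d (F d p) = G d p"
proof -
  obtain x y where p: "p = (x, y)" by (cases p)
  define a where "a = y + d"
  define b where "b = x * y * d + a"
  have pos: "x > 0" "y > 0" "a > 0" "b > 0"
    using assms by (auto simp: p quadrant_def a_def b_def intro!: add_pos_pos)
  have F: "F d p = (a / (x * y), b / (y * a))"
    by (simp add: p F_def a_def b_def algebra_simps)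
  have "1 / (b / (y * a)) + d / (a / (x * y) * (b / (y * a))) = y * (a + x * y * d) / b"
    using pos by (simp add: field_simps)
  also have "\<dots> = y"
    using pos by (simp add: b_def add.commute)
  finally have 1: "1 / (b / (y * a)) + d / (a / (x * y) * (b / (y * a))) = y" .
  have "b / (y * a) + 1 / (a / (x * y)) = (x * y * (d + y) + a) / (y * a)"
    using pos by (simp add: b_def field_simps)
  also have "\<dots> = (x * y + 1) * a / (y * a)"
    by (simp add: a_def algebra_simps)
  also have "\<dots> = x + 1 / y"
    using pos by (simp add: field_simps)
  finally have 2: "b / (y * a) + 1 / (a / (x * y)) = x + 1 / y" .
  have 3: "a / (x * y) = 1 / x + d / (x * y)"
    using pos by (simp add: a_def field_simps)
  have "G d (F d p) = a / (x * y) + (b / (y * a) + 1 / (a / (x * y)))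
      + (1 / (b / (y * a)) + d / (a / (x * y) * (b / (y * a))))"
    unfolding F G_def by simp
  also have "\<dots> = G d p"
    unfolding 1 2 unfolding 3 p G_def by simp
  finally show ?thesis .
qed

lemma F_step_iff:
  assumes "d > 0" "(x, y) \<in> quadrant"
  shows "(x', y') = F d (x, y) \<longleftrightarrow> x' * x = 1 + d / y \<and> y' * y = 1 + d / x'"
proof -
  have pos: "x > 0" "y > 0" "y + d > 0" using assms by (auto simp: quadrant_def)
  have "x' * x = 1 + d / y \<longleftrightarrow> x' = (y + d) / (x * y)"
    using pos by (auto simp: field_simps)
  moreover have "y' * y = 1 + d / x' \<longleftrightarrow> y' = (d * x * y + y + d) / (y * (y + d))"
    if x': "x' = (y + d) / (x * y)"
  proof -
    have "1 + d / x' = (d * x * y + y + d) / (y + d)"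
      unfolding x' using pos by (simp add: field_simps)
    moreover have "y' * y = c / e \<longleftrightarrow> y' = c / (y * e)" for c e
      using pos by (metis divide_divide_eq_left' eq_divide_eq less_irrefl mult.commute)
    ultimately show ?thesis by simp
  qed
  ultimately show ?thesis by (auto simp: F_def)
qed

lemma positive_solution_iff:
  assumes "d > 0"
  shows "positive_solution d u v \<longleftrightarrow>
    (u 0, v 0) \<in> quadrant \<and> (\<forall>n. (u n, v n) = (F d ^^ n) (u 0, v 0))"
    (is "_ \<longleftrightarrow> ?Q")
proof
  assume sol: "positive_solution d u v"
  then have q: "(u n, v n) \<in> quadrant" for n
    by (auto simp: positive_solution_def quadrant_def)
  have step: "(u (Suc n), v (Suc n)) = F d (u n, v n)" for n
    using sol F_step_iff[OF assms q] by (auto simp: positive_solution_def)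
  have "(u n, v n) = (F d ^^ n) (u 0, v 0)" for n
    by (induction n) (simp_all only: funpow.simps o_apply id_apply step)
  with q show ?Q by blast
next
  assume ?Q
  then have q0: "(u 0, v 0) \<in> quadrant" and it: "\<And>n. (u n, v n) = (F d ^^ n) (u 0, v 0)"
    by blast+
  have step: "(u (Suc n), v (Suc n)) = F d (u n, v n)" for n
    by (simp only: it[of "Suc n"] it[of n] funpow.simps o_apply)
  have q: "(u n, v n) \<in> quadrant" for n
    by (induction n) (use q0 F_quadrant[OF assms] in \<open>simp_all only: step\<close>)
  show "positive_solution d u v"
    using q step F_step_iff[OF assms q] by (auto simp: positive_solution_def quadrant_def)
qed

end

theory Submission
  imports Defs "HOL-Complex_Analysis.Complex_Analysis" "HOL-Real_Asymp.Real_Asymp"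
begin

text \<open>
The map \<open>F\<close> is the square of the Lyness-type map \<open>\<Phi> (x, y) = (y, (y + d) / (x y))\<close>, which also
leaves \<open>G\<close> invariant. On a level curve \<open>G = K\<close>, which is the positive oval of the cubic
\<open>g = x y (x + y) + (x + y) + d - K x y = 0\<close>, the map \<open>\<Phi>\<close> preserves the Hamiltonian field
\<open>(- g\<^sub>y, g\<^sub>x) / 2\<close>. A solution of this field runs around the oval periodically, so \<open>\<Phi>\<close> acts on the
oval as a shift of time, and \<open>F\<close> as twice that shift: on each curve \<open>F\<close> is conjugate to a rotation.
Its points are all periodic if the ratio of shift and period is rational, and all have dense orbits
if it is irrational (Kronecker).

The ratio is made explicit without elliptic functions. The curve meets the diagonal in a point
\<open>(s, s)\<close> with \<open>s > ell d\<close>. The line through \<open>(s, s)\<close> with direction angle \<open>\<psi> / 2\<close> meets the oval in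
exactly one further point, and along the flow \<open>\<psi>\<close> satisfies \<open>\<psi>' = sqrt (disc d s \<psi>)\<close>, where
\<open>disc\<close> is the discriminant of the quadratic equation for that point (\<open>oval_ode\<close>). Here
\<open>\<psi> = - pi / 2\<close> is the tangent at \<open>(s, s)\<close> and \<open>\<psi> = 0\<close> is the horizontal chord, whose end point
\<open>\<Phi>\<close> sends to \<open>(s, s)\<close>. Hence \<open>\<Phi>\<close> shifts time by \<open>- a\<close> and the period is \<open>2 (a + b)\<close>, where \<open>a\<close> and \<open>b\<close>
are the integrals of \<open>1 / sqrt disc\<close> over \<open>[- pi / 2, 0]\<close> and \<open>[0, pi / 2]\<close> (\<open>lyness_translation\<close>);
the rotation number of \<open>F\<close> is \<open>a / (a + b)\<close> up to sign.

The heart of the matter is that this number is not constant on any interval of levels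
(\<open>quarter_ratio_not_constant\<close>). Both \<open>a\<close> and \<open>b\<close> are real-analytic in \<open>s\<close>, so if \<open>a = c b\<close> on some
interval, then \<open>a = c b\<close> for all \<open>s > ell d\<close>. As \<open>s\<close> tends to infinity, \<open>s a\<close> and \<open>s b\<close> grow like
\<open>2 ln s\<close> and \<open>3/2 ln s\<close>, which forces \<open>c = 4 / 3\<close>. Then \<open>7 a = 2 (2 (a + b))\<close>, so \<open>\<Phi>\<^sup>7\<close> is the identity
on every curve. But \<open>\<Phi>\<^sup>7 (s, s) = (s, s)\<close> is a nontrivial polynomial condition on \<open>s\<close>, whatever \<open>d\<close> is.
(The number 7 is no accident: for large \<open>s\<close>, in logarithmic scale, \<open>\<Phi>\<close> becomes the piecewise linear
recurrence \<open>z'' = max 0 (- z') - z\<close>, all of whose solutions have period 7.)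

Therefore the rotation number maps every interval of parameters \<open>s\<close> onto a set containing an interval.
Rational and irrational values both occur arbitrarily close to any level, and since the point
with a fixed parameter \<open>\<psi>\<close> moves continuously with \<open>s\<close>, both kinds of curves are dense. For the second claim,
a sieve estimate shows that a fixed interval contains a reduced fraction \<open>j / q\<close> for every
large \<open>q\<close>; on a curve with that rotation number every point has minimal period \<open>q\<close>.
\<close>

section \<open>The chords through a diagonal point of a level curve\<close>

lemma ell_root:
  assumes "d > 0"
  shows "ell d > 0" "ell d ^ 3 - ell d - d = 0"
  using theI'[OF ell_ex1[OF assms]] by (auto simp: ell_def)

text \<open>The value of \<open>G\<close> at the diagonal point \<open>(s, s)\<close>; it parametrises the levels by \<open>s\<close>.\<close>

definition level :: "real \<Rightarrow> real \<Rightarrow> real" where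
  "level d s = 2 * s + 2 / s + d / s\<^sup>2"

text \<open>The product with \<open>s\<close> is \<open>s\<^sup>3 - s - d\<close>, the polynomial that defines \<open>ell d\<close>. Geometrically, the
horizontal and vertical chords from \<open>(s, s)\<close> have length \<open>excess d s / s\<close>.\<close>

definition excess :: "real \<Rightarrow> real \<Rightarrow> real" where
  "excess d s = s\<^sup>2 - 1 - d / s"

text \<open>Half of the amount by which the level exceeds the sum of the coordinates of \<open>(s, s)\<close>.\<close>

definition half_gap :: "real \<Rightarrow> real \<Rightarrow> real" where
  "half_gap d s = 1 / s + d / (2 * s\<^sup>2)"

text \<open>Put \<open>(x, y) = (s + r cos \<phi>, s + r sin \<phi>)\<close> into the cubic and divide by \<open>r\<close>. What remains is a
quadratic equation in \<open>r\<close>; in terms of \<open>\<psi> = 2 * \<phi>\<close>, a function of period \<open>2 * pi\<close> since a line has no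
orientation, its discriminant is \<open>disc d s \<psi>\<close> and its linear coefficient is \<open>lin_coeff d s \<psi>\<close>.\<close>

definition disc :: "real \<Rightarrow> real \<Rightarrow> real \<Rightarrow> real" where
  "disc d s \<psi> = s\<^sup>2 * (cos \<psi>)\<^sup>2 + d / s * sin \<psi> * (1 + sin \<psi>) + (half_gap d s)\<^sup>2 * (sin \<psi>)\<^sup>2"

definition lin_coeff :: "real \<Rightarrow> real \<Rightarrow> real \<Rightarrow> real" where
  "lin_coeff d s \<psi> = s * (1 + sin \<psi>) - half_gap d s * sin \<psi>"

text \<open>The root of the quadratic equation that lies on the oval has this denominator in the form of the
quadratic formula that rationalises the numerator. That form has no singularity at
vertical, horizontal or tangent lines, where the leading coefficient vanishes.\<close>

definition den :: "real \<Rightarrow> real \<Rightarrow> real \<Rightarrow> real" where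
  "den d s \<psi> = lin_coeff d s \<psi> + sqrt (disc d s \<psi>)"

definition oval_x :: "real \<Rightarrow> real \<Rightarrow> real \<Rightarrow> real" where
  "oval_x d s \<psi> = s - excess d s * (1 + sin \<psi> + cos \<psi>) / den d s \<psi>"

definition oval_y :: "real \<Rightarrow> real \<Rightarrow> real \<Rightarrow> real" where
  "oval_y d s \<psi> = s - excess d s * (1 + sin \<psi> - cos \<psi>) / den d s \<psi>"

lemma curve_iff:
  "(x, y) \<in> curve d K \<longleftrightarrow> x > 0 \<and> y > 0 \<and> x * y * (x + y) + (x + y) + d - K * x * y = 0"
proof (cases "x > 0 \<and> y > 0")
  case True
  then have "G d (x, y) = K \<longleftrightarrow> G d (x, y) * (x * y) = K * (x * y)" by simp
  also have "G d (x, y) * (x * y) = x * y * (x + y) + (x + y) + d"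
    using True by (simp add: G_def field_simps)
  finally show ?thesis using True by (auto simp: curve_def quadrant_def algebra_simps)
qed (auto simp: curve_def quadrant_def)

locale oval =
  fixes d s :: real
  assumes d_pos: "d > 0" and s_gt: "s > ell d"
begin

abbreviation "e \<equiv> excess d s"
abbreviation "h \<equiv> half_gap d s"
abbreviation "K \<equiv> level d s"

lemma s_pos: "s > 0" using s_gt ell_root[OF d_pos] by linarith

lemma e_pos: "e > 0"
proof -
  note r = ell_root[OF d_pos]
  have "ell d * ((ell d)\<^sup>2 - 1) = d"
    using r by (simp add: algebra_simps power2_eq_square power3_eq_cube)
  then have "(ell d)\<^sup>2 - 1 > 0" using r d_pos by (metis zero_less_mult_pos)
  moreover have "(ell d)\<^sup>2 < s\<^sup>2" using s_gt r by (simp add: power_strict_mono)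
  ultimately have "ell d * ((ell d)\<^sup>2 - 1) < s * (s\<^sup>2 - 1)"
    using s_gt r by (intro mult_strict_mono) auto
  then have "d < s * (s\<^sup>2 - 1)" using \<open>ell d * ((ell d)\<^sup>2 - 1) = d\<close> by simp
  then show ?thesis using s_pos by (simp add: excess_def field_simps)
qed

lemma h_pos: "h > 0" using s_pos d_pos by (simp add: half_gap_def add_pos_pos)

lemma h_eq: "2 * s\<^sup>2 * h = 2 * s + d"
  using s_pos by (simp add: half_gap_def field_simps power2_eq_square)

lemma e_eq: "s * e = s ^ 3 - s - d"
  using s_pos by (simp add: excess_def field_simps power2_eq_square power3_eq_cube)

lemma hs_eq: "2 * h * s = 1 + s\<^sup>2 - e"
  using s_pos by (simp add: half_gap_def excess_def field_simps power2_eq_square)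

lemma K_eq: "K = 2 * s + 2 * h"
  using s_pos by (simp add: half_gap_def level_def field_simps power2_eq_square)

text \<open>The definition shows positivity when \<open>sin \<psi>\<close> is positive, this form when it is negative.\<close>

lemma disc_eq: "disc d s \<psi> = (lin_coeff d s \<psi>)\<^sup>2 - 2 * e * sin \<psi> * (1 + sin \<psi>)"
proof -
  have ds: "d / s = s\<^sup>2 - 1 - e" by (simp add: excess_def)
  have c: "(cos \<psi>)\<^sup>2 = 1 - (sin \<psi>)\<^sup>2" by (simp add: cos_squared_eq)
  have "disc d s \<psi> - ((lin_coeff d s \<psi>)\<^sup>2 - 2 * e * sin \<psi> * (1 + sin \<psi>))
     = (2 * h * s - (1 + s\<^sup>2 - e)) * (sin \<psi> * (1 + sin \<psi>))"
    unfolding disc_def lin_coeff_def ds c by (simp add: power2_eq_square algebra_simps)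
  then show ?thesis using hs_eq by simp
qed

lemma disc_den_pos: "disc d s \<psi> > 0" "den d s \<psi> > 0"
proof -
  let ?S = "sin \<psi>"
  have S: "-1 \<le> ?S" "?S \<le> 1" by auto
  have "disc d s \<psi> > 0 \<and> den d s \<psi> > 0"
  proof (cases "?S \<le> 0")
    case True
    have "lin_coeff d s \<psi> > 0"
    proof (cases "?S = 0")
      case False
      with True have "h * ?S < 0" using h_pos by (simp add: mult_pos_neg)
      moreover have "s * (1 + ?S) \<ge> 0"
        by (intro mult_nonneg_nonneg) (use s_pos S in linarith)+
      ultimately show ?thesis by (simp add: lin_coeff_def)
    qed (use s_pos in \<open>simp add: lin_coeff_def\<close>)
    moreover have "?S * (1 + ?S) \<le> 0" using True S by (intro mult_nonpos_nonneg) linarith+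
    then have "e * (?S * (1 + ?S)) \<le> 0" using e_pos by (simp add: mult_nonneg_nonpos)
    moreover have "(lin_coeff d s \<psi>)\<^sup>2 > 0" using \<open>lin_coeff d s \<psi> > 0\<close> by simp
    ultimately have "disc d s \<psi> > 0" unfolding disc_eq mult.assoc by linarith
    with \<open>lin_coeff d s \<psi> > 0\<close> show ?thesis by (simp add: den_def add_pos_pos)
  next
    case False
    then have "d / s * ?S * (1 + ?S) > 0" using d_pos s_pos by simp
    then have gt: "disc d s \<psi> > (h * ?S)\<^sup>2"
      unfolding disc_def power_mult_distrib using zero_le_power2[of "s * cos \<psi>", unfolded power_mult_distrib]
      by linarith
    moreover have "sqrt (disc d s \<psi>) > h * ?S"
      using gt by (intro real_less_rsqrt)
    moreover have "s * (1 + ?S) > 0" using s_pos False by simp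
    ultimately show ?thesis unfolding den_def lin_coeff_def
      using zero_le_power2[of "h * ?S"] by linarith
  qed
  then show "disc d s \<psi> > 0" "den d s \<psi> > 0" by auto
qed

lemma continuous_inverse_sqrt_disc: "continuous_on A (\<lambda>\<psi>. 1 / sqrt (disc d s \<psi>))"
  using disc_den_pos(1) unfolding disc_def
  by (auto intro!: continuous_intros simp: s_pos less_imp_neq[symmetric])

abbreviation "w \<psi> \<equiv> 1 / den d s \<psi>"

text \<open>The quadratic equation for the second intersection point, in the reciprocal unknown.\<close>

lemma w_root: "1 - 2 * lin_coeff d s \<psi> * w \<psi> + 2 * e * sin \<psi> * (1 + sin \<psi>) * (w \<psi>)\<^sup>2 = 0"
proof -
  let ?D = "den d s \<psi>"
  have "(?D - lin_coeff d s \<psi>)\<^sup>2 = disc d s \<psi>"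
    using disc_den_pos(1)[of \<psi>] by (simp add: den_def)
  then have "?D\<^sup>2 - 2 * lin_coeff d s \<psi> * ?D + 2 * e * sin \<psi> * (1 + sin \<psi>) = 0"
    by (simp add: disc_eq power2_eq_square algebra_simps)
  then have "(?D\<^sup>2 - 2 * lin_coeff d s \<psi> * ?D + 2 * e * sin \<psi> * (1 + sin \<psi>)) / ?D\<^sup>2 = 0" by simp
  then show ?thesis
    using disc_den_pos(2)[of \<psi>] by (simp add: diff_divide_distrib add_divide_distrib power2_eq_square)
qed

lemma oval_cubic:
  defines "x \<equiv> oval_x d s" and "y \<equiv> oval_y d s"
  shows "x \<psi> + y \<psi> = 2 * s - 2 * e * (1 + sin \<psi>) * w \<psi>"
    and "x \<psi> * y \<psi> = s\<^sup>2 - e - 2 * e * h * sin \<psi> * w \<psi>"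
    and "x \<psi> * y \<psi> * (x \<psi> + y \<psi>) + (x \<psi> + y \<psi>) + d - K * x \<psi> * y \<psi> = 0"
proof -
  let ?S = "sin \<psi>" and ?C = "cos \<psi>" and ?w = "w \<psi>"
  have CS: "?C\<^sup>2 = 1 - ?S\<^sup>2" by (simp add: cos_squared_eq)
  have xy: "x \<psi> = s - e * (1 + ?S + ?C) * ?w" "y \<psi> = s - e * (1 + ?S - ?C) * ?w"
    by (simp_all add: x_def y_def oval_x_def oval_y_def)
  note w = w_root[of \<psi>, unfolded lin_coeff_def]
  show sum: "x \<psi> + y \<psi> = 2 * s - 2 * e * (1 + ?S) * ?w"
    by (simp add: xy algebra_simps)
  show prod: "x \<psi> * y \<psi> = s\<^sup>2 - e - 2 * e * h * ?S * ?w"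
    unfolding xy using CS w by algebra
  have "(x \<psi> * y \<psi>) * (x \<psi> + y \<psi>) + (x \<psi> + y \<psi>) + d - K * (x \<psi> * y \<psi>) = 0"
    unfolding sum prod K_eq using w hs_eq h_eq by algebra
  then show "x \<psi> * y \<psi> * (x \<psi> + y \<psi>) + (x \<psi> + y \<psi>) + d - K * x \<psi> * y \<psi> = 0"
    by (simp add: mult.assoc)
qed

lemma continuous_oval: "continuous_on UNIV (oval_x d s)" "continuous_on UNIV (oval_y d s)"
  using disc_den_pos(2) unfolding oval_x_def oval_y_def den_def lin_coeff_def disc_def
  by (auto intro!: continuous_intros simp: less_imp_neq[symmetric] s_pos)

lemma oval_special:
  "oval_x d s 0 = (s + d) / s\<^sup>2" "oval_y d s 0 = s"
  "oval_x d s (- pi / 2) = s" "oval_y d s (- pi / 2) = s"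
proof -
  have "den d s 0 = 2 * s" using s_pos by (simp add: den_def lin_coeff_def disc_def)
  then show "oval_x d s 0 = (s + d) / s\<^sup>2" 
    using s_pos by (simp add: oval_x_def excess_def field_simps power2_eq_square)
  show "oval_y d s 0 = s" by (simp add: oval_y_def)
  show "oval_x d s (- pi / 2) = s" "oval_y d s (- pi / 2) = s"
    by (simp_all add: oval_x_def oval_y_def)
qed

text \<open>The cubic equation holds along the whole parametrisation, so only positivity of the coordinates is
at stake. It holds at \<open>(s, s)\<close> and cannot be lost: on the nonnegative coordinate axes the cubic is at least
\<open>d > 0\<close>.\<close>

lemma oval_in_curve: "(oval_x d s \<psi>, oval_y d s \<psi>) \<in> curve d K"
proof -
  \<comment> \<open>The set is open; it is also closed, since weak inequalities define the same set.\<close>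
  define Z where "Z = {\<psi>. 0 < oval_x d s \<psi>} \<inter> {\<psi>. 0 < oval_y d s \<psi>}"
  have "Z = {\<psi>. 0 \<le> oval_x d s \<psi>} \<inter> {\<psi>. 0 \<le> oval_y d s \<psi>}"
  proof -
    have "oval_x d s \<psi> \<noteq> 0" "oval_y d s \<psi> \<noteq> 0" if "0 \<le> oval_x d s \<psi>" "0 \<le> oval_y d s \<psi>" for \<psi>
      using oval_cubic(3)[of \<psi>] that d_pos by auto
    then show ?thesis unfolding Z_def by (auto simp: less_le)
  qed
  then have "closed Z"
    by (auto intro!: closed_Int closed_Collect_le continuous_on_const continuous_oval)
  moreover have "open Z"
    unfolding Z_def by (auto intro!: open_Int open_Collect_less continuous_on_const continuous_oval)
  moreover have "- pi / 2 \<in> Z"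
    unfolding Z_def using oval_special s_pos by auto
  ultimately have "Z = UNIV" by (metis clopen empty_iff)
  then have "0 < oval_x d s \<psi>" "0 < oval_y d s \<psi>" by (auto simp: Z_def)
  with oval_cubic(3)[of \<psi>] show ?thesis by (simp add: curve_iff)
qed

text \<open>A line through \<open>(s, s)\<close> cannot meet the positive part of the cubic in three points. The products of
the first and of the second coordinates of three collinear points of the cubic are determined, by Vieta,
by the values of the cubic at the two points where the line crosses the axes; they are never both positive.\<close>

lemma oval_surj:
  assumes "(x, y) \<in> curve d K"
  shows "\<exists>\<psi>. x = oval_x d s \<psi> \<and> y = oval_y d s \<psi>"
proof (cases "x = s \<and> y = s")
  case True
  then show ?thesis using oval_special by metis
next
  case False
  have xy: "x > 0" "y > 0" and g: "x * y * (x + y) + (x + y) + d - K * x * y = 0"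
    using assms by (auto simp: curve_iff)
  define z where "z = Complex (x - s) (y - s)"
  define r where "r = cmod z"
  define c where "c = cos (Arg z)"
  define n where "n = sin (Arg z)"
  define \<psi> where "\<psi> = 2 * Arg z"
  have "z \<noteq> 0" using False by (auto simp: z_def complex_eq_iff)
  then have r: "r > 0" by (simp add: r_def)
  have "z = rcis r (Arg z)" by (simp add: r_def rcis_cmod_Arg)
  then have "Re z = r * c" "Im z = r * n" unfolding c_def n_def by (metis Re_rcis, metis Im_rcis)
  then have x: "x = s + r * c" and y: "y = s + r * n" by (auto simp: z_def)
  have cn: "c\<^sup>2 + n\<^sup>2 = 1" by (simp add: c_def n_def)
  have S: "sin \<psi> = 2 * n * c" and C: "cos \<psi> = c\<^sup>2 - n\<^sup>2"
    by (simp_all add: \<psi>_def c_def n_def sin_double cos_double)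
  define v where "v = w \<psi>"
  \<comment> \<open>The signed distance from \<open>(s, s)\<close> to the parametrised point on the line through \<open>(x, y)\<close>.\<close>
  define t where "t = - 2 * e * (c + n) * v"
  have t: "oval_x d s \<psi> = s + t * c" "oval_y d s \<psi> = s + t * n"
    using cn unfolding oval_x_def oval_y_def S C t_def v_def
    by (simp_all add: field_simps power2_eq_square) algebra+
  have pos: "s + t * c > 0" "s + t * n > 0"
    using oval_in_curve[of \<psi>] unfolding t by (auto simp: curve_iff)
  define m where "m = s * (c + n)\<^sup>2 - 2 * h * c * n"
  have lin: "lin_coeff d s \<psi> = m" using cn unfolding lin_coeff_def S m_def by algebra
  have qt: "c * n * (c + n) * t\<^sup>2 + m * t + (c + n) * e = 0"
    using w_root[of \<psi>] cn unfolding lin S v_def[symmetric] t_def by algebra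
  have "r * (c * n * (c + n) * r\<^sup>2 + m * r + (c + n) * e) = 0"
    using g e_eq h_eq hs_eq cn unfolding x y K_eq m_def by algebra
  then have qr: "c * n * (c + n) * r\<^sup>2 + m * r + (c + n) * e = 0" using r by simp
  have "r = t"
  proof (rule ccontr)
    assume "r \<noteq> t"
    have "(r - t) * (c * n * (c + n) * (r + t) + m) = 0" using qt qr by algebra
    then have sum: "c * n * (c + n) * (r + t) = - m" using \<open>r \<noteq> t\<close> by auto
    show False
    proof (cases "c + n = 0")
      case True
      then have "m * r = 0" using qr by simp
      then have "h * c * n = 0" using r True by (simp add: m_def)
      then have "c * n = 0" using h_pos by simp
      with True cn show False by auto
    next
      case cpn: False
      show False
      proof (cases "c * n = 0")
        case True
        then have "m = s * (c + n)\<^sup>2" by (auto simp: m_def)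
        with True sum cpn s_pos show False by auto
      next
        case False
        have "(c + n) * (c * n * (r * t) - e) = 0"
          using qr sum by algebra
        then have prod: "c * n * (r * t) = e" using cpn by simp
        \<comment> \<open>Multiplied by \<open>s\<close>, these are the products of the coordinates of the three collinear points.\<close>
        define X where "X = x * (s + t * c)"
        define Y where "Y = y * (s + t * n)"
        have XY: "X > 0" "Y > 0" using xy pos by (auto simp: X_def Y_def)
        have E1: "c\<^sup>2 * (s + d) - s * (c * n) = - s * (n * (c + n)) * X"
          unfolding X_def x using sum prod e_eq h_eq unfolding m_def by algebra
        have E2: "n\<^sup>2 * (s + d) - s * (c * n) = - s * (c * (c + n)) * Y"
          unfolding Y_def y using sum prod e_eq h_eq unfolding m_def by algebra
        have sq: "c\<^sup>2 > 0" "n\<^sup>2 > 0" using False by auto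
        show False
        proof (cases "c * n > 0")
          case True
          then have "n * (c + n) > 0" "c * (c + n) > 0"
            using sq by (auto simp: algebra_simps power2_eq_square)
          then have "- s * (n * (c + n)) * X < 0" "- s * (c * (c + n)) * Y < 0"
            using s_pos XY by auto
          then have "c\<^sup>2 * (s + d) < s * (c * n)" "n\<^sup>2 * (s + d) < s * (c * n)"
            using E1 E2 by linarith+
          moreover have "c\<^sup>2 * d > 0" "n\<^sup>2 * d > 0" using sq d_pos by auto
          ultimately have "s * c\<^sup>2 < s * (c * n)" "s * n\<^sup>2 < s * (c * n)"
            by (simp_all add: algebra_simps)
          then have "c\<^sup>2 < c * n" "n\<^sup>2 < c * n" using s_pos by auto
          moreover have "(c - n)\<^sup>2 \<ge> 0" by simp
          ultimately show False by (simp add: power2_eq_square algebra_simps)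
        next
          case cn_neg: False
          with False have neg: "c * n < 0" by linarith
          then have "s * (c * n) < 0" using s_pos by (simp add: mult_pos_neg)
          moreover have "c\<^sup>2 * (s + d) > 0" "n\<^sup>2 * (s + d) > 0" using sq s_pos d_pos by auto
          ultimately have "- s * (n * (c + n)) * X > 0" "- s * (c * (c + n)) * Y > 0"
            using E1 E2 by linarith+
          then have "n * (c + n) < 0" "c * (c + n) < 0"
            using s_pos XY by (auto simp: zero_less_mult_iff mult_less_0_iff)
          then have "(n * (c + n)) * (c * (c + n)) > 0" by (rule mult_neg_neg)
          then have "c * n * (c + n)\<^sup>2 > 0" by (simp add: power2_eq_square mult_ac)
          moreover have "(c + n)\<^sup>2 > 0" using cpn by simp
          ultimately have "c * n > 0" by (rule zero_less_mult_pos2)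
          with neg show False by simp
        qed
      qed
    qed
  qed
  then show ?thesis using t x y by (intro exI[of _ \<psi>]) simp
qed

end

section \<open>The invariant flow on a level curve\<close>

text \<open>Together with \<open>field_y\<close> this is \<open>(- g\<^sub>y, g\<^sub>x) / 2\<close> for \<open>g = x y (x + y) + (x + y) + d - K x y\<close>; the
factor \<open>1 / 2\<close> makes the parameter \<open>\<psi>\<close> move with speed \<open>sqrt (disc d s \<psi>)\<close>.\<close>

definition field_x :: "real \<Rightarrow> real \<Rightarrow> real \<Rightarrow> real" where
  "field_x K x y = - (x\<^sup>2 + 2 * x * y + 1 - K * x) / 2"

definition field_y :: "real \<Rightarrow> real \<Rightarrow> real \<Rightarrow> real" where
  "field_y K x y = (2 * x * y + y\<^sup>2 + 1 - K * y) / 2"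

text \<open>The recurrence \<open>u\<^sub>n\<^sub>+\<^sub>2 u\<^sub>n = 1 + d / u\<^sub>n\<^sub>+\<^sub>1\<close>. The two equations of the system are this recurrence for the
interleaved sequence of the \<open>u\<^sub>n\<close> and \<open>v\<^sub>n\<close>.\<close>

definition lyness :: "real \<Rightarrow> real \<times> real \<Rightarrow> real \<times> real" where
  "lyness d = (\<lambda>(x, y). (y, (y + d) / (x * y)))"

text \<open>The flow times from the tangent line at \<open>(s, s)\<close> to the horizontal chord and, in \<open>quarter_pos\<close>, from there to
the chord along the diagonal. By the symmetry of the curve in the diagonal they make up half a period.\<close>

definition quarter_neg :: "real \<Rightarrow> real \<Rightarrow> real" where
  "quarter_neg d s = integral {- (pi / 2)..0} (\<lambda>\<psi>. 1 / sqrt (disc d s \<psi>))"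

definition quarter_pos :: "real \<Rightarrow> real \<Rightarrow> real" where
  "quarter_pos d s = integral {0..pi / 2} (\<lambda>\<psi>. 1 / sqrt (disc d s \<psi>))"

lemma gronwall_zero:
  fixes E E' :: "real \<Rightarrow> real"
  assumes deriv: "\<And>t. (E has_real_derivative E' t) (at t)"
    and bound: "\<And>t. \<bar>E' t\<bar> \<le> M * E t" and nonneg: "\<And>t. E t \<ge> 0" and init: "E 0 = 0"
  shows "E t = 0"
proof -
  have "E t \<le> 0" if "t \<ge> 0"
  proof -
    have "E t * exp (- M * t) \<le> E 0 * exp (- M * 0)"
    proof (rule DERIV_nonpos_imp_nonincreasing[OF that])
      fix u
      have "((\<lambda>t. E t * exp (- M * t)) has_real_derivative (E' u - M * E u) * exp (- M * u)) (at u)"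
        by (auto intro!: derivative_eq_intros deriv simp: algebra_simps)
      moreover have "(E' u - M * E u) * exp (- M * u) \<le> 0"
        using bound[of u] by (intro mult_nonpos_nonneg) auto
      ultimately show "\<exists>y. ((\<lambda>t. E t * exp (- M * t)) has_real_derivative y) (at u) \<and> y \<le> 0" by blast
    qed
    then show ?thesis using init by (simp add: mult_le_0_iff)
  qed
  moreover have "E t \<le> 0" if "t \<le> 0"
  proof -
    have "E t * exp (M * t) \<le> E 0 * exp (M * 0)"
    proof (rule DERIV_nonneg_imp_nondecreasing[OF that])
      fix u
      have "((\<lambda>t. E t * exp (M * t)) has_real_derivative (E' u + M * E u) * exp (M * u)) (at u)"
        by (auto intro!: derivative_eq_intros deriv simp: algebra_simps)
      moreover have "(E' u + M * E u) * exp (M * u) \<ge> 0"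
        using bound[of u] by (intro mult_nonneg_nonneg) auto
      ultimately show "\<exists>y. ((\<lambda>t. E t * exp (M * t)) has_real_derivative y) (at u) \<and> 0 \<le> y" by blast
    qed
    then show ?thesis using init by (simp add: mult_le_0_iff)
  qed
  ultimately show ?thesis using nonneg[of t] by linarith
qed

lemma curve_bounded:
  assumes "d > 0" "(x, y) \<in> curve d K"
  shows "0 < x" "x < K" "0 < y" "y < K"
proof -
  have xy: "x > 0" "y > 0" "G d (x, y) = K" using assms by (auto simp: curve_def quadrant_def)
  then show "0 < x" "0 < y" by auto
  have "0 < 1 / x" "0 < 1 / y" "0 < d / (x * y)" using xy assms by auto
  moreover have "K = x + y + 1 / x + 1 / y + d / (x * y)" using xy(3) by (simp add: G_def)
  ultimately show "x < K" "y < K" using xy by linarith+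
qed

text \<open>The field is polynomial, hence Lipschitz on the box \<open>(0, K) \<times> (0, K)\<close> that contains the curve, so the squared
distance of two solutions satisfies a linear differential inequality.\<close>

lemma flow_unique:
  fixes X Y X' Y' :: "real \<Rightarrow> real"
  assumes d: "d > 0"
    and X: "\<And>t. (X has_real_derivative field_x K (X t) (Y t)) (at t)"
    and Y: "\<And>t. (Y has_real_derivative field_y K (X t) (Y t)) (at t)"
    and X': "\<And>t. (X' has_real_derivative field_x K (X' t) (Y' t)) (at t)"
    and Y': "\<And>t. (Y' has_real_derivative field_y K (X' t) (Y' t)) (at t)"
    and c: "\<And>t. (X t, Y t) \<in> curve d K" and c': "\<And>t. (X' t, Y' t) \<in> curve d K"
    and init: "X 0 = X' 0" "Y 0 = Y' 0"
  shows "X t = X' t \<and> Y t = Y' t"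
proof -
  define E where "E t = (X t - X' t)\<^sup>2 + (Y t - Y' t)\<^sup>2" for t
  define E' where "E' t = 2 * (X t - X' t) * (field_x K (X t) (Y t) - field_x K (X' t) (Y' t))
    + 2 * (Y t - Y' t) * (field_y K (X t) (Y t) - field_y K (X' t) (Y' t))" for t
  have "E t = 0"
  \<comment> \<open>On the box, \<open>E'\<close> has coefficients at most \<open>5 * K\<close> at the two squares and \<open>4 * K\<close> at the mixed term.\<close>
  proof (rule gronwall_zero[where M = "14 * K" and E = E and E' = E' and t = t])
    show "(E has_real_derivative E' t) (at t)" for t
      unfolding E_def[abs_def] E'_def by (auto intro!: derivative_eq_intros X Y X' Y' simp: algebra_simps)
    show "E t \<ge> 0" for t by (simp add: E_def)
    show "E 0 = 0" by (simp add: E_def init)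
    fix t
    note b = curve_bounded[OF d c[of t]] curve_bounded[OF d c'[of t]]
    define u where "u = X t - X' t"
    define v where "v = Y t - Y' t"
    have E'_eq: "E' t = - u\<^sup>2 * (X t + X' t + 2 * Y t - K) + v\<^sup>2 * (2 * X t + Y t + Y' t - K)
        + u * v * (2 * Y' t - 2 * X' t)"
      unfolding E'_def field_x_def field_y_def u_def v_def
      by (simp add: field_simps power2_eq_square)
    have "\<bar>u\<^sup>2 * (X t + X' t + 2 * Y t - K)\<bar> \<le> u\<^sup>2 * (5 * K)"
      unfolding abs_mult using b by (intro mult_mono) auto
    moreover have "\<bar>v\<^sup>2 * (2 * X t + Y t + Y' t - K)\<bar> \<le> v\<^sup>2 * (5 * K)"
      unfolding abs_mult using b by (intro mult_mono) auto
    moreover have "\<bar>u * v * (2 * Y' t - 2 * X' t)\<bar> \<le> (u\<^sup>2 + v\<^sup>2) * (4 * K)"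
    proof -
      have "\<bar>u * v\<bar> \<le> u\<^sup>2 + v\<^sup>2"
        using sum_squares_bound[of u v] sum_squares_bound[of u "- v"] zero_le_power2[of u] zero_le_power2[of v]
        unfolding abs_le_iff power2_minus mult_minus_right by linarith
      then show ?thesis unfolding abs_mult[of "u * v"] using b by (intro mult_mono) auto
    qed
    ultimately have "\<bar>E' t\<bar> \<le> u\<^sup>2 * (5 * K) + v\<^sup>2 * (5 * K) + (u\<^sup>2 + v\<^sup>2) * (4 * K)"
      unfolding E'_eq by linarith
    also have "\<dots> \<le> 14 * K * E t"
      unfolding E_def u_def[symmetric] v_def[symmetric] using b(2) b(1)
      by (simp add: algebra_simps)
    finally show "\<bar>E' t\<bar> \<le> 14 * K * E t" .
  qed
  then show ?thesis by (simp add: E_def add_nonneg_eq_0_iff)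
qed

lemma lyness_curve:
  assumes "d > 0" "(x, y) \<in> curve d K"
  shows "lyness d (x, y) \<in> curve d K"
proof -
  have xy: "x > 0" "y > 0" and g: "x * y * (x + y) + (x + y) + d - K * x * y = 0"
    using assms by (auto simp: curve_iff)
  define z where "z = (y + d) / (x * y)"
  have z: "x * y * z = y + d" "z > 0" using xy assms by (auto simp: z_def)
  have "x * (y * z * (y + z) + (y + z) + d - K * y * z) = 0"
    using g z(1) xy by algebra
  moreover have "lyness d (x, y) = (y, z)" by (simp add: lyness_def z_def)
  ultimately show ?thesis using xy z(2) by (simp add: curve_iff)
qed

lemma F_eq_lyness:
  assumes "d > 0" "p \<in> quadrant"
  shows "F d p = lyness d (lyness d p)"
proof -
  obtain x y where p: "p = (x, y)" "x > 0" "y > 0" using assms by (cases p) (auto simp: quadrant_def)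
  have "((y + d) / (x * y) + d) / (y * ((y + d) / (x * y))) = (d * x * y + y + d) / (y * (y + d))"
  proof -
    have "(a / b + d) / (y * (a / b)) = (d * b + a) / (y * a)" if "a > 0" "b > 0" for a b :: real
      using that p(3) by (simp add: field_simps)
    from this[of "y + d" "x * y"] show ?thesis using p(2,3) assms(1) by (simp add: mult_ac add_ac)
  qed
  then show ?thesis by (simp add: p F_def lyness_def)
qed

text \<open>Replacing \<open>x\<close> by \<open>(y + d) / (x y)\<close> exchanges the two roots of \<open>g\<close> as a quadratic polynomial in \<open>x\<close>, and
its derivative takes opposite values at the two roots. So this exchange
reverses the field; the swap of coordinates reverses it once more.\<close>

lemma lyness_flow:
  fixes X Y :: "real \<Rightarrow> real"
  assumes d: "d > 0"
    and X: "(X has_real_derivative field_x K (X t) (Y t)) (at t)"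
    and Y: "(Y has_real_derivative field_y K (X t) (Y t)) (at t)"
    and c: "(X t, Y t) \<in> curve d K"
  defines "Z \<equiv> \<lambda>t. (Y t + d) / (X t * Y t)"
  shows "(Y has_real_derivative field_x K (Y t) (Z t)) (at t)"
    and "(Z has_real_derivative field_y K (Y t) (Z t)) (at t)"
proof -
  have xy: "X t > 0" "Y t > 0" and g: "X t * Y t * (X t + Y t) + (X t + Y t) + d - K * X t * Y t = 0"
    using c by (auto simp: curve_iff)
  have z: "X t * Y t * Z t = Y t + d" using xy by (simp add: Z_def)
  have "X t * (field_y K (X t) (Y t) - field_x K (Y t) (Z t)) = 0"
    unfolding field_x_def field_y_def using g z by (simp add: field_simps) algebra
  then have "field_y K (X t) (Y t) = field_x K (Y t) (Z t)" using xy by simp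
  with Y show "(Y has_real_derivative field_x K (Y t) (Z t)) (at t)" by simp
  let ?A = "field_x K (X t) (Y t)" and ?B = "field_y K (X t) (Y t)"
  have "(Z has_real_derivative (?B * (X t * Y t) - (Y t + d) * (?A * Y t + X t * ?B)) / (X t * Y t)\<^sup>2) (at t)"
    unfolding Z_def using xy by (auto intro!: derivative_eq_intros X Y simp: power2_eq_square)
  moreover have "?B * (X t * Y t) - (Y t + d) * (?A * Y t + X t * ?B) = field_y K (Y t) (Z t) * (X t * Y t)\<^sup>2"
  proof -
    have "X t * Y t * (?B * (X t * Y t) - (Y t + d) * (?A * Y t + X t * ?B) - field_y K (Y t) (Z t) * (X t * Y t)\<^sup>2) = 0"
      unfolding field_x_def field_y_def using g z by (simp add: field_simps) algebra
    then show ?thesis using xy by simp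
  qed
  ultimately show "(Z has_real_derivative field_y K (Y t) (Z t)) (at t)" using xy by simp
qed

context oval
begin

text \<open>Differentiating the discriminant in the form \<open>disc_eq\<close> makes the square root cancel from the numerator.\<close>

lemma w_deriv:
  "(w has_real_derivative - ((s - h) * cos \<psi> * w \<psi> - e * cos \<psi> * (1 + 2 * sin \<psi>) * (w \<psi>)\<^sup>2)
      / sqrt (disc d s \<psi>)) (at \<psi>)"
proof -
  let ?R = "sqrt (disc d s \<psi>)" and ?D = "den d s \<psi>"
  define dd where "dd = lin_coeff d s \<psi> * ((s - h) * cos \<psi>) - e * cos \<psi> * (1 + 2 * sin \<psi>)"
  have lin: "(lin_coeff d s has_real_derivative (s - h) * cos \<psi>) (at \<psi>)"
    unfolding lin_coeff_def[abs_def] by (auto intro!: derivative_eq_intros simp: algebra_simps)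
  have "(disc d s has_real_derivative 2 * dd) (at \<psi>)"
    unfolding disc_eq[abs_def] dd_def
    by (auto intro!: derivative_eq_intros lin simp: algebra_simps)
  then have den: "(den d s has_real_derivative (s - h) * cos \<psi> + dd / ?R) (at \<psi>)"
    unfolding den_def[abs_def] using disc_den_pos(1)[of \<psi>]
    by (auto intro!: derivative_eq_intros lin simp: field_simps)
  have R: "?R > 0" "?D > 0" "?R = ?D - lin_coeff d s \<psi>" using disc_den_pos[of \<psi>] by (auto simp: den_def)
  have "(w has_real_derivative - ((s - h) * cos \<psi> + dd / ?R) / ?D\<^sup>2) (at \<psi>)"
    using R by (auto intro!: derivative_eq_intros den simp: power2_eq_square)
  also have "- ((s - h) * cos \<psi> + dd / ?R) / ?D\<^sup>2
      = - (?R * ((s - h) * cos \<psi>) + dd) / ?D\<^sup>2 / ?R"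
  proof -
    have "(s - h) * cos \<psi> + dd / ?R = (?R * ((s - h) * cos \<psi>) + dd) / ?R"
      using less_imp_neq[OF R(1), symmetric] by (simp add: add_divide_distrib del: real_sqrt_eq_zero_cancel_iff)
    then show ?thesis by (simp only: divide_divide_eq_left mult.commute flip: minus_divide_left)
  qed
  also have "?R * ((s - h) * cos \<psi>) + dd = ?D * ((s - h) * cos \<psi>) - e * cos \<psi> * (1 + 2 * sin \<psi>)"
    unfolding R(3) dd_def by (simp add: algebra_simps)
  also have "- (?D * ((s - h) * cos \<psi>) - e * cos \<psi> * (1 + 2 * sin \<psi>)) / ?D\<^sup>2
      = - ((s - h) * cos \<psi> * w \<psi> - e * cos \<psi> * (1 + 2 * sin \<psi>) * (w \<psi>)\<^sup>2)"
    using R(2) by (simp add: field_simps power2_eq_square)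
  finally show ?thesis .
qed

text \<open>Along the parametrisation the flow is \<open>\<psi>' = sqrt (disc d s \<psi>)\<close>. After multiplication by
\<open>sqrt disc = den - lin_coeff\<close> both sides are polynomials in \<open>w\<close>, \<open>sin \<psi>\<close> and \<open>cos \<psi>\<close>, and the identity follows from
the quadratic equation for \<open>w\<close>.\<close>

lemma oval_ode:
  defines "x \<equiv> oval_x d s" and "y \<equiv> oval_y d s"
  shows "(x has_real_derivative field_x K (x \<psi>) (y \<psi>) / sqrt (disc d s \<psi>)) (at \<psi>)"
    and "(y has_real_derivative field_y K (x \<psi>) (y \<psi>) / sqrt (disc d s \<psi>)) (at \<psi>)"
proof -
  let ?R = "sqrt (disc d s \<psi>)" and ?S = "sin \<psi>" and ?C = "cos \<psi>"
  define v where "v = w \<psi>"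
  define v' where "v' = - ((s - h) * ?C * v - e * ?C * (1 + 2 * ?S) * v\<^sup>2)"
  have R: "?R > 0" "?R * v = 1 - lin_coeff d s \<psi> * v"
    using disc_den_pos[of \<psi>] by (auto simp: v_def den_def field_simps)
  have w': "(w has_real_derivative v' / ?R) (at \<psi>)"
    unfolding v'_def v_def by (rule w_deriv)
  have CS: "?C\<^sup>2 = 1 - ?S\<^sup>2" by (simp add: cos_squared_eq)
  have xy: "x \<psi> = s - e * (1 + ?S + ?C) * v" "y \<psi> = s - e * (1 + ?S - ?C) * v"
    by (simp_all add: x_def y_def oval_x_def oval_y_def v_def)
  have x: "x = (\<lambda>\<psi>. s - e * (1 + sin \<psi> + cos \<psi>) * w \<psi>)"
    and y: "y = (\<lambda>\<psi>. s - e * (1 + sin \<psi> - cos \<psi>) * w \<psi>)"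
    by (simp_all add: x_def y_def oval_x_def oval_y_def fun_eq_iff)
  note wr = w_root[of \<psi>, folded v_def]
  have "2 * (- e * ((?C - ?S) * (1 - lin_coeff d s \<psi> * v) + (1 + ?S + ?C) * v'))
      = - ((x \<psi>)\<^sup>2 + 2 * x \<psi> * y \<psi> + 1 - K * x \<psi>)"
    unfolding xy K_eq v'_def lin_coeff_def using wr[unfolded lin_coeff_def] CS hs_eq by algebra
  then have fx: "- e * ((?C - ?S) * (?R * v) + (1 + ?S + ?C) * v') = field_x K (x \<psi>) (y \<psi>)"
    unfolding R(2) field_x_def by simp
  have "2 * (- e * ((?C + ?S) * (1 - lin_coeff d s \<psi> * v) + (1 + ?S - ?C) * v'))
      = 2 * x \<psi> * y \<psi> + (y \<psi>)\<^sup>2 + 1 - K * y \<psi>"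
    unfolding xy K_eq v'_def lin_coeff_def using wr[unfolded lin_coeff_def] CS hs_eq by algebra
  then have fy: "- e * ((?C + ?S) * (?R * v) + (1 + ?S - ?C) * v') = field_y K (x \<psi>) (y \<psi>)"
    unfolding R(2) field_y_def by simp
  have gen: "((\<lambda>\<psi>. s - e * (1 + sin \<psi> + cos \<psi>) * u \<psi>) has_real_derivative
        - e * ((?C - ?S) * u \<psi> + (1 + ?S + ?C) * u')) (at \<psi>)"
      "((\<lambda>\<psi>. s - e * (1 + sin \<psi> - cos \<psi>) * u \<psi>) has_real_derivative
        - e * ((?C + ?S) * u \<psi> + (1 + ?S - ?C) * u')) (at \<psi>)"
    if "(u has_real_derivative u') (at \<psi>)" for u u'
    by (auto intro!: derivative_eq_intros that simp: algebra_simps)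
  have "(x has_real_derivative - e * ((?C - ?S) * v + (1 + ?S + ?C) * (v' / ?R))) (at \<psi>)"
    unfolding x v_def using gen(1)[OF w'] .
  also have "- e * ((?C - ?S) * v + (1 + ?S + ?C) * (v' / ?R)) = field_x K (x \<psi>) (y \<psi>) / ?R"
    unfolding fx[symmetric] using R(1) by (simp add: field_simps)
  finally show "(x has_real_derivative field_x K (x \<psi>) (y \<psi>) / ?R) (at \<psi>)" .
  have "(y has_real_derivative - e * ((?C + ?S) * v + (1 + ?S - ?C) * (v' / ?R))) (at \<psi>)"
    unfolding y v_def using gen(2)[OF w'] .
  also have "- e * ((?C + ?S) * v + (1 + ?S - ?C) * (v' / ?R)) = field_y K (x \<psi>) (y \<psi>) / ?R"
    unfolding fy[symmetric] using R(1) by (simp add: field_simps)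
  finally show "(y has_real_derivative field_y K (x \<psi>) (y \<psi>) / ?R) (at \<psi>)" .
qed

end

context oval
begin

abbreviation "T \<equiv> 2 * (quarter_neg d s + quarter_pos d s)"

text \<open>The period of the antiderivative is expressed by the two quarter times because \<open>disc\<close> is invariant
under \<open>\<psi> \<mapsto> pi - \<psi>\<close>, the reflection of the curve in the diagonal.\<close>

lemma exists_time:
  obtains \<tau> where "\<And>\<psi>. (\<tau> has_real_derivative 1 / sqrt (disc d s \<psi>)) (at \<psi>)"
    "\<tau> 0 = 0" "\<tau> (- pi / 2) = - quarter_neg d s" "\<And>\<psi>. \<tau> (\<psi> + 2 * pi) = \<tau> \<psi> + T"
    "T > 0"
proof -
  have cont: "isCont (\<lambda>\<psi>. 1 / sqrt (disc d s \<psi>)) \<psi>" for \<psi>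
    using continuous_inverse_sqrt_disc[of UNIV] by (simp add: continuous_on_eq_continuous_at)
  obtain \<tau>\<^sub>0 where \<tau>\<^sub>0: "(\<tau>\<^sub>0 has_real_derivative 1 / sqrt (disc d s \<psi>)) (at \<psi>)" for \<psi>
    using einterval_antiderivative[of "-\<infinity>" "\<infinity>" "\<lambda>\<psi>. 1 / sqrt (disc d s \<psi>)"] cont
    by (auto simp: has_real_derivative_iff_has_vector_derivative)
  define \<tau> where "\<tau> \<psi> = \<tau>\<^sub>0 \<psi> - \<tau>\<^sub>0 0" for \<psi>
  have deriv: "(\<tau> has_real_derivative 1 / sqrt (disc d s \<psi>)) (at \<psi>)" for \<psi>
    unfolding \<tau>_def[abs_def] by (auto intro!: derivative_eq_intros \<tau>\<^sub>0)
  have int: "integral {a..b} (\<lambda>\<psi>. 1 / sqrt (disc d s \<psi>)) = \<tau> b - \<tau> a" if "a \<le> b" for a b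
    by (intro integral_unique fundamental_theorem_of_calculus that)
       (use deriv in \<open>auto simp: has_real_derivative_iff_has_vector_derivative intro: has_vector_derivative_at_within\<close>)
  have \<tau>0: "\<tau> 0 = 0" by (simp add: \<tau>_def)
  have neg: "\<tau> (- pi / 2) = - quarter_neg d s"
    unfolding quarter_neg_def by (subst int) (auto simp: \<tau>0)
  have pos: "\<tau> (pi / 2) = quarter_pos d s"
    unfolding quarter_pos_def by (subst int) (auto simp: \<tau>0)
  have mono: "\<tau> a < \<tau> b" if "a < b" for a b
    by (rule DERIV_pos_imp_increasing[OF that]) (use deriv disc_den_pos(1) in \<open>force\<close>)
  have refl: "\<tau> (pi - \<psi>) + \<tau> \<psi> = 2 * \<tau> (pi / 2)" for \<psi>
  proof -
    have "disc d s (pi - \<psi>) = disc d s \<psi>" for \<psi> by (simp add: disc_def)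
    then have "((\<lambda>\<psi>. \<tau> (pi - \<psi>) + \<tau> \<psi>) has_real_derivative 0) (at \<psi>)" for \<psi>
      using deriv[of "pi - \<psi>"] deriv[of \<psi>]
      by (auto intro!: derivative_eq_intros DERIV_chain2[where f = \<tau> and g = "\<lambda>\<psi>. pi - \<psi>"])
    from DERIV_isconst_all[OF allI[OF this], of \<psi> "pi / 2"] show ?thesis by simp
  qed
  have per: "\<tau> (\<psi> + 2 * pi) - \<tau> \<psi> = T" for \<psi>
  proof -
    have "disc d s (\<psi> + 2 * pi) = disc d s \<psi>" for \<psi> by (simp add: disc_def)
    then have "((\<lambda>\<psi>. \<tau> (\<psi> + 2 * pi) - \<tau> \<psi>) has_real_derivative 0) (at \<psi>)" for \<psi>
      using deriv[of "\<psi> + 2 * pi"] deriv[of \<psi>]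
      by (auto intro!: derivative_eq_intros DERIV_chain2[where f = \<tau> and g = "\<lambda>\<psi>. \<psi> + 2 * pi"])
    from DERIV_isconst_all[OF allI[OF this], of \<psi> "- pi / 2"]
    have "\<tau> (\<psi> + 2 * pi) - \<tau> \<psi> = \<tau> (- pi / 2 + 2 * pi) - \<tau> (- pi / 2)" .
    also have "\<tau> (- pi / 2 + 2 * pi) = 2 * \<tau> (pi / 2) - \<tau> (- pi / 2)"
      using refl[of "- pi / 2"] by (simp add: algebra_simps)
    finally show ?thesis using neg pos by simp
  qed
  have "T > 0" using per[of 0] mono[of 0 "2 * pi"] by simp
  with that deriv \<tau>0 neg per show ?thesis by (metis add.commute diff_add_cancel)
qed

lemma exists_flow:
  obtains X Y :: "real \<Rightarrow> real" where
    "\<And>t. (X has_real_derivative field_x K (X t) (Y t)) (at t)"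
    "\<And>t. (Y has_real_derivative field_y K (X t) (Y t)) (at t)"
    "\<And>t. (X t, Y t) \<in> curve d K"
    "\<And>x y. (x, y) \<in> curve d K \<Longrightarrow> \<exists>t. x = X t \<and> y = Y t"
    "X 0 = (s + d) / s\<^sup>2" "Y 0 = s" "X (- quarter_neg d s) = s" "Y (- quarter_neg d s) = s"
    "\<And>t. X t = X 0 \<and> Y t = Y 0 \<longleftrightarrow> (\<exists>n::int. t = of_int n * T)"
    "T > 0"
proof -
  obtain \<tau> where \<tau>: "\<And>\<psi>. (\<tau> has_real_derivative 1 / sqrt (disc d s \<psi>)) (at \<psi>)"
    "\<tau> 0 = 0" "\<tau> (- pi / 2) = - quarter_neg d s" and per: "\<And>\<psi>. \<tau> (\<psi> + 2 * pi) = \<tau> \<psi> + T"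
    and T: "T > 0" using exists_time by metis
  have mono: "\<tau> a < \<tau> b" if "a < b" for a b
    by (rule DERIV_pos_imp_increasing[OF that]) (use \<tau>(1) disc_den_pos(1) in \<open>force\<close>)
  have inj: "inj \<tau>"
    by (rule injI) (metis mono less_irrefl linorder_neqE_linordered_idom)
  have cont: "isCont \<tau> \<psi>" for \<psi> using \<tau>(1) DERIV_isCont by blast
  have per_n: "\<tau> (2 * pi * of_nat n) = of_nat n * T" for n
  proof (induction n)
    case (Suc n)
    then show ?case using per[of "2 * pi * of_nat n"] by (simp add: algebra_simps)
  qed (simp add: \<tau>)
  have per_z: "\<tau> (2 * pi * of_int n) = of_int n * T" for n
  proof (cases "n \<ge> 0")
    case True
    then show ?thesis using per_n[of "nat n"] by simp
  next
    case False
    \<comment> \<open>Climbing from a negative multiple of the period to \<open>0\<close>.\<close>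
    have shift: "\<tau> (\<psi> + 2 * pi * of_nat m) = \<tau> \<psi> + of_nat m * T" for \<psi> m
    proof (induction m)
      case (Suc m)
      then show ?case using per[of "\<psi> + 2 * pi * of_nat m"] by (simp add: algebra_simps)
    qed simp
    show ?thesis using False shift[of "2 * pi * of_int n" "nat (- n)"] \<tau>(2) by (simp add: algebra_simps)
  qed
  have surj: "\<exists>\<psi>. \<tau> \<psi> = t" for t
  proof -
    obtain n where n: "\<bar>t\<bar> < of_nat n * T" using T reals_Archimedean3 by blast
    have "\<tau> (2 * pi * of_int (- int n)) \<le> t" "t \<le> \<tau> (2 * pi * of_int (int n))"
      unfolding per_z using n by (auto simp: abs_less_iff)
    then show ?thesis
      using IVT[of \<tau> "2 * pi * of_int (- int n)" t "2 * pi * of_int (int n)"] cont by auto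
  qed
  define \<phi> where "\<phi> = inv \<tau>"
  have \<tau>\<phi>: "\<tau> (\<phi> t) = t" for t using surj unfolding \<phi>_def by (metis f_inv_into_f rangeI)
  have \<phi>\<tau>: "\<phi> (\<tau> \<psi>) = \<psi>" for \<psi> using inj by (simp add: \<phi>_def)
  have \<phi>: "(\<phi> has_real_derivative sqrt (disc d s (\<phi> t))) (at t)" for t
  proof -
    have "isCont \<phi> (\<tau> (\<phi> t))"
      by (rule isCont_inverse_function[where d = 1]) (auto simp: \<phi>\<tau> cont)
    then have "isCont \<phi> t" by (simp add: \<tau>\<phi>)
    then have "(\<phi> has_real_derivative inverse (1 / sqrt (disc d s (\<phi> t)))) (at t)"
      using disc_den_pos(1)[of "\<phi> t"]
      by (intro DERIV_inverse_function[where f = \<tau> and a = "t - 1" and b = "t + 1"]) (auto simp: \<tau>\<phi> \<tau>(1))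
    then show ?thesis by simp
  qed
  define X where "X t = oval_x d s (\<phi> t)" for t
  define Y where "Y t = oval_y d s (\<phi> t)" for t
  show ?thesis
  proof (rule that[of X Y])
    fix t
    have R: "sqrt (disc d s (\<phi> t)) \<noteq> 0" using disc_den_pos(1)[of "\<phi> t"] by simp
    show "(X has_real_derivative field_x K (X t) (Y t)) (at t)"
      using DERIV_chain2[OF oval_ode(1) \<phi>, of t] R by (simp add: X_def[abs_def] Y_def)
    show "(Y has_real_derivative field_y K (X t) (Y t)) (at t)"
      using DERIV_chain2[OF oval_ode(2) \<phi>, of t] R by (simp add: Y_def[abs_def] X_def)
    show "(X t, Y t) \<in> curve d K" by (simp add: X_def Y_def oval_in_curve)
    have \<phi>0: "\<phi> 0 = 0" using \<phi>\<tau>[of 0] \<tau>(2) by simp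
    show X0: "X 0 = (s + d) / s\<^sup>2" and Y0: "Y 0 = s"
      by (simp_all add: X_def Y_def \<phi>0 oval_special)
    have "\<phi> (- quarter_neg d s) = - pi / 2" using \<phi>\<tau>[of "- pi / 2"] \<tau>(3) by simp
    then show "X (- quarter_neg d s) = s" "Y (- quarter_neg d s) = s"
      by (simp_all only: X_def Y_def oval_special)
    show "X t = X 0 \<and> Y t = Y 0 \<longleftrightarrow> (\<exists>n::int. t = of_int n * T)"
    proof
      assume eq: "X t = X 0 \<and> Y t = Y 0"
      let ?S = "sin (\<phi> t)" and ?C = "cos (\<phi> t)"
      have "e * (1 + ?S - ?C) / den d s (\<phi> t) = 0"
        using eq Y0 by (simp add: Y_def oval_y_def)
      then have C: "?C = 1 + ?S" using e_pos disc_den_pos(2)[of "\<phi> t"] by simp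
      have "?S\<^sup>2 + ?C\<^sup>2 = 1" by simp
      then have "?S * (1 + ?S) = 0" unfolding C by (simp add: power2_eq_square algebra_simps)
      moreover have "1 + ?S \<noteq> 0"
      proof
        assume "1 + ?S = 0"
        with C have "oval_x d s (\<phi> t) = s" by (simp add: oval_x_def)
        then have "(s + d) / s\<^sup>2 = s" using eq X0 by (simp add: X_def)
        then have "s + d = s ^ 3" using s_pos by (simp add: field_simps power2_eq_square power3_eq_cube)
        then show False using e_eq mult_pos_pos[OF s_pos e_pos] by simp
      qed
      ultimately have "?S = 0" by simp
      with C have "sin (\<phi> t) = sin 0 \<and> cos (\<phi> t) = cos 0" by simp
      then obtain n :: int where "\<phi> t = 0 + 2 * pi * of_int n" using sin_cos_eq_iff by blast
      then have "t = of_int n * T" using \<tau>\<phi>[of t] per_z[of n] by simp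
      then show "\<exists>n::int. t = of_int n * T" by blast
    next
      assume "\<exists>n::int. t = of_int n * T"
      then obtain n :: int where n: "t = \<tau> (2 * pi * of_int n)" using per_z by metis
      then have "sin (\<phi> t) = sin 0 \<and> cos (\<phi> t) = cos 0"
        unfolding n \<phi>\<tau> using sin_cos_eq_iff by fastforce
      then show "X t = X 0 \<and> Y t = Y 0"
        unfolding X_def Y_def \<phi>0 oval_x_def oval_y_def den_def lin_coeff_def disc_def by simp
    qed
    show "T > 0" by (rule T)
  next
    fix x y assume "(x, y) \<in> curve d K"
    from oval_surj[OF this] show "\<exists>t. x = X t \<and> y = Y t"
      unfolding X_def Y_def by (metis \<phi>\<tau>)
  qed
qed

text \<open>Both \<open>t \<mapsto> \<Phi> (Z t)\<close> and \<open>t \<mapsto> Z (t - quarter_neg d s)\<close> are solutions, and they agree at \<open>t = 0\<close> because \<open>\<Phi>\<close> sends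
the end point of the horizontal chord to \<open>(s, s)\<close>. Uniqueness of solutions does the rest.\<close>

lemma lyness_translation:
  obtains Z :: "real \<Rightarrow> real \<times> real" where
    "continuous_on UNIV Z" "range Z = curve d K" "T > 0"
    "\<And>t. lyness d (Z t) = Z (t - quarter_neg d s)"
    "\<And>t u. Z t = Z u \<longleftrightarrow> (\<exists>n::int. t - u = of_int n * T)"
proof -
  obtain X Y where X: "\<And>t. (X has_real_derivative field_x K (X t) (Y t)) (at t)"
    and Y: "\<And>t. (Y has_real_derivative field_y K (X t) (Y t)) (at t)"
    and c: "\<And>t. (X t, Y t) \<in> curve d K"
    and onto: "\<And>x y. (x, y) \<in> curve d K \<Longrightarrow> \<exists>t. x = X t \<and> y = Y t"
    and init: "X 0 = (s + d) / s\<^sup>2" "Y 0 = s" "X (- quarter_neg d s) = s" "Y (- quarter_neg d s) = s"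
    and per: "\<And>t. X t = X 0 \<and> Y t = Y 0 \<longleftrightarrow> (\<exists>n::int. t = of_int n * T)"
    and T: "T > 0"
    using exists_flow by blast
  have shift: "((\<lambda>t. X (t + u)) has_real_derivative field_x K (X (t + u)) (Y (t + u))) (at t)"
    "((\<lambda>t. Y (t + u)) has_real_derivative field_y K (X (t + u)) (Y (t + u))) (at t)" for t u
    using X[of "t + u"] Y[of "t + u"] by (simp_all add: DERIV_shift)
  define Z where "Z t = (X t, Y t)" for t
  show ?thesis
  proof (rule that[of Z])
    show "T > 0" by (rule T)
    show "continuous_on UNIV Z"
      unfolding Z_def using X Y
      by (intro continuous_on_Pair continuous_at_imp_continuous_on ballI DERIV_isCont)
    show "range Z = curve d K" unfolding Z_def using c onto by fastforce
    show "lyness d (Z t) = Z (t - quarter_neg d s)" for t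
    proof -
      let ?X' = Y and ?Y' = "\<lambda>t. (Y t + d) / (X t * Y t)"
      have c': "(?X' t, ?Y' t) \<in> curve d K" for t
        using lyness_curve[OF d_pos c[of t]] by (simp add: lyness_def)
      have "?Y' 0 = s"
      proof -
        have "(s + d) / ((s + d) / s\<^sup>2 * s) = s"
        proof -
          have "(s + d) / s\<^sup>2 * s = (s + d) / s" using s_pos by (simp add: power2_eq_square)
          then show ?thesis using s_pos d_pos by simp
        qed
        then show ?thesis by (simp add: init)
      qed
      then have "?X' t = X (t + - quarter_neg d s) \<and> ?Y' t = Y (t + - quarter_neg d s)"
        by (intro flow_unique[OF d_pos lyness_flow[OF d_pos X Y c] shift c' c]) (simp_all add: init)
      then have "Y t = X (t - quarter_neg d s)" "(Y t + d) / (X t * Y t) = Y (t - quarter_neg d s)"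
        unfolding add_uminus_conv_diff by blast+
      then show ?thesis by (simp only: Z_def lyness_def prod.case)
    qed
    show "Z t = Z u \<longleftrightarrow> (\<exists>n::int. t - u = of_int n * T)" for t u
    proof
      assume "Z t = Z u"
      then have "X (- t + t) = X (- t + u) \<and> Y (- t + t) = Y (- t + u)"
        using flow_unique[OF d_pos shift(1)[where u = t] shift(2)[where u = t] shift(1)[where u = u] shift(2)[where u = u] c c, of "- t"]
        by (simp add: Z_def)
      then have "X (u - t) = X 0 \<and> Y (u - t) = Y 0" by (simp add: algebra_simps)
      then obtain n :: int where "u - t = of_int n * T" using per by blast
      then have "t - u = of_int (- n) * T" by (simp add: algebra_simps)
      then show "\<exists>n::int. t - u = of_int n * T" by blast
    next
      assume "\<exists>n::int. t - u = of_int n * T"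
      then have "X (t - u) = X 0 \<and> Y (t - u) = Y 0" using per by blast
      then have "X (u + (t - u)) = X (u + 0) \<and> Y (u + (t - u)) = Y (u + 0)"
        by (intro flow_unique[OF d_pos shift(1)[where u = "t - u"] shift(2)[where u = "t - u"]
              shift(1)[where u = 0] shift(2)[where u = 0] c c, of u]) simp_all
      then show "Z t = Z u" by (simp add: Z_def)
    qed
  qed
qed

lemma lyness_funpow:
  assumes "\<And>t. lyness d (Z t) = Z (t - quarter_neg d s)"
  shows "(lyness d ^^ n) (Z t) = Z (t - of_nat n * quarter_neg d s)"
proof (induction n)
  case (Suc n)
  then show ?case using assms by (simp add: algebra_simps)
qed simp

lemma F_funpow:
  assumes "\<And>t. lyness d (Z t) = Z (t - quarter_neg d s)" "range Z = curve d K"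
  shows "(F d ^^ n) (Z t) = Z (t - 2 * of_nat n * quarter_neg d s)"
proof (induction n)
  case (Suc n)
  have "Z u \<in> quadrant" for u using assms(2) by (auto simp: curve_def)
  then have "F d (Z u) = Z (u - 2 * quarter_neg d s)" for u
    by (simp add: F_eq_lyness[OF d_pos] assms(1) algebra_simps)
  with Suc show ?case by (simp add: algebra_simps)
qed simp

end

section \<open>The rotation number\<close>

text \<open>The time shift of \<open>F\<close> divided by the period, up to sign.\<close>

definition rotation_number :: "real \<Rightarrow> real \<Rightarrow> real" where
  "rotation_number d s = quarter_neg d s / (quarter_neg d s + quarter_pos d s)"

context oval
begin

lemma quarters_pos: "quarter_neg d s > 0" "quarter_pos d s > 0"
proof -
  have "integral {a..b} (\<lambda>\<psi>. 1 / sqrt (disc d s \<psi>)) > 0" if "a < b" for a b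
  proof -
    note cont = continuous_inverse_sqrt_disc[of "{a..b}"]
    have int: "(\<lambda>\<psi>. 1 / sqrt (disc d s \<psi>)) integrable_on {a..b}"
      by (intro integrable_continuous_real cont)
    have nn: "1 / sqrt (disc d s \<psi>) \<ge> 0" for \<psi> using disc_den_pos(1)[of \<psi>] by simp
    have "integral {a..b} (\<lambda>\<psi>. 1 / sqrt (disc d s \<psi>)) \<noteq> 0"
    proof
      assume "integral {a..b} (\<lambda>\<psi>. 1 / sqrt (disc d s \<psi>)) = 0"
      then have "1 / sqrt (disc d s a) = 0"
        using integral_eq_0_iff[OF cont that nn] that by auto
      then show False using disc_den_pos(1)[of a] by simp
    qed
    moreover have "integral {a..b} (\<lambda>\<psi>. 1 / sqrt (disc d s \<psi>)) \<ge> 0"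
      using nn by (intro integral_nonneg int) auto
    ultimately show ?thesis by linarith
  qed
  from this[of "- (pi / 2)" 0] this[of 0 "pi / 2"]
  show "quarter_neg d s > 0" "quarter_pos d s > 0"
    by (auto simp: quarter_neg_def quarter_pos_def)
qed

lemma rot_times_period: "rotation_number d s * T = 2 * quarter_neg d s"
  using quarters_pos by (simp add: rotation_number_def field_simps)

lemma F_funpow_fixed_iff:
  assumes p: "p \<in> curve d K"
  shows "(F d ^^ n) p = p \<longleftrightarrow> of_nat n * rotation_number d s \<in> \<int>"
proof -
  obtain Z where cont: "continuous_on UNIV Z" and Z: "range Z = curve d K" "T > 0"
      "\<And>t. lyness d (Z t) = Z (t - quarter_neg d s)"
      "\<And>t u. Z t = Z u \<longleftrightarrow> (\<exists>m::int. t - u = of_int m * T)"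
    by (rule lyness_translation) (rule that)
  obtain t where t: "p = Z t" using p Z(1) by (metis rangeE)
  have eq: "- (2 * of_nat n * quarter_neg d s) = of_int m * T \<longleftrightarrow> of_nat n * rotation_number d s = of_int (- m)" for m
  proof -
    define \<tau> where "\<tau> = T"
    have "rotation_number d s * \<tau> = 2 * quarter_neg d s" "\<tau> \<noteq> 0"
      using rot_times_period Z(2) by (simp_all add: \<tau>_def)
    then have "of_int m * \<tau> + 2 * of_nat n * quarter_neg d s = (of_nat n * rotation_number d s + of_int m) * \<tau>"
      by algebra
    moreover have "- (2 * of_nat n * quarter_neg d s) = of_int m * \<tau>
        \<longleftrightarrow> of_int m * \<tau> + 2 * of_nat n * quarter_neg d s = 0" by linarith
    ultimately have "- (2 * of_nat n * quarter_neg d s) = of_int m * \<tau>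
        \<longleftrightarrow> of_nat n * rotation_number d s + of_int m = 0" using \<open>\<tau> \<noteq> 0\<close> by simp
    then show ?thesis unfolding \<tau>_def[symmetric] of_int_minus by linarith
  qed
  have "(F d ^^ n) p = p \<longleftrightarrow> (\<exists>m::int. - (2 * of_nat n * quarter_neg d s) = of_int m * T)"
    unfolding t F_funpow[OF Z(3,1)] Z(4) by simp
  also have "\<dots> \<longleftrightarrow> (\<exists>m::int. of_nat n * rotation_number d s = of_int (- m))"
    unfolding eq ..
  also have "\<dots> \<longleftrightarrow> of_nat n * rotation_number d s \<in> \<int>"
  proof
    assume "of_nat n * rotation_number d s \<in> \<int>"
    then obtain k :: int where "of_nat n * rotation_number d s = of_int k" by (elim Ints_cases)
    then show "\<exists>m::int. of_nat n * rotation_number d s = of_int (- m)" by (intro exI[of _ "- k"]) simp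
  qed (elim exE, simp only: Ints_of_int)
  finally show ?thesis .
qed

lemma rational_rotation_periodic:
  assumes "p \<in> curve d K"
  shows "periodic_point (F d) p \<longleftrightarrow> rotation_number d s \<in> \<rat>"
proof
  assume "periodic_point (F d) p"
  then obtain n where n: "n > 0" "of_nat n * rotation_number d s \<in> \<int>"
    using F_funpow_fixed_iff[OF assms] by (auto simp: periodic_point_def)
  then have "rotation_number d s = (of_nat n * rotation_number d s) / of_nat n" by simp
  also have "\<dots> \<in> \<rat>" using n(2) Ints_subset_Rats by (intro Rats_divide) auto
  finally show "rotation_number d s \<in> \<rat>" .
next
  assume "rotation_number d s \<in> \<rat>"
  then obtain a b :: int where b: "b > 0" "rotation_number d s = of_int a / of_int b"
    by (auto elim!: Rats_cases')
  then have "of_nat (nat b) * rotation_number d s = of_int a" by simp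
  then have "of_nat (nat b) * rotation_number d s \<in> \<int>" by simp
  moreover have "nat b > 0" using b by simp
  ultimately show "periodic_point (F d) p"
    unfolding periodic_point_def F_funpow_fixed_iff[OF assms] by blast
qed

lemma irrational_rotation_dense:
  assumes p: "p \<in> curve d K" and irr: "rotation_number d s \<notin> \<rat>"
  shows "dense_subset (forward_orbit (F d) p) (curve d K)"
proof -
  obtain Z where cont: "continuous_on UNIV Z" and Z: "range Z = curve d K" "T > 0"
      "\<And>t. lyness d (Z t) = Z (t - quarter_neg d s)"
      "\<And>t u. Z t = Z u \<longleftrightarrow> (\<exists>m::int. t - u = of_int m * T)"
    by (rule lyness_translation) (rule that)
  obtain t where t: "p = Z t" using p Z(1) by (metis rangeE)
  have orbit: "(F d ^^ n) p = Z (t - 2 * of_nat n * quarter_neg d s)" for n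
    unfolding t by (rule F_funpow[OF Z(3,1)])
  show ?thesis
    unfolding dense_subset_def
  proof
    show "forward_orbit (F d) p \<subseteq> curve d K"
      using Z(1) by (auto simp: forward_orbit_def orbit)
    show "curve d K \<subseteq> closure (forward_orbit (F d) p)"
    proof
      fix q assume "q \<in> curve d K"
      then obtain u where u: "q = Z u" using Z(1) by (metis rangeE)
      show "q \<in> closure (forward_orbit (F d) p)"
        unfolding closure_approachable
      proof (intro allI impI)
        fix \<epsilon> :: real assume "\<epsilon> > 0"
        then obtain \<delta> where \<delta>: "\<delta> > 0" "\<And>v. \<bar>v - u\<bar> < \<delta> \<Longrightarrow> dist (Z v) q < \<epsilon>"
          using cont unfolding continuous_on_iff u dist_real_def by blast
        have "\<delta> / T > 0" using \<delta> Z(2) by simp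
        then obtain m k :: int where k: "k > 0"
          "\<bar>of_int k * rotation_number d s - of_int m - (t - u) / T\<bar> < \<delta> / T"
          using sequence_of_fractional_parts_is_dense[OF irr, of "\<delta> / T" "(t - u) / T"] by blast
        have "t - 2 * of_int k * quarter_neg d s + of_int m * T - u
            = - ((of_int k * rotation_number d s - of_int m - (t - u) / T) * T)"
        proof -
          have "t - 2 * of_int k * a + of_int m * c - u = - ((of_int k * r - of_int m - y) * c)"
            if "r * c = 2 * a" "y * c = t - u" for a c r y :: real
            using that by algebra
          then show ?thesis using rot_times_period Z(2) by simp
        qed
        then have "\<bar>t - 2 * of_int k * quarter_neg d s + of_int m * T - u\<bar> < \<delta>"
          using k(2) Z(2) by (simp add: abs_mult pos_less_divide_eq)
        then have "dist (Z (t - 2 * of_int k * quarter_neg d s + of_int m * T)) q < \<epsilon>" by (rule \<delta>(2))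
        moreover have "Z (t - 2 * of_int k * quarter_neg d s + of_int m * T) = Z (t - 2 * of_int k * quarter_neg d s)"
          unfolding Z(4) by (rule exI[of _ m]) simp
        moreover have "Z (t - 2 * of_int k * quarter_neg d s) = (F d ^^ nat k) p"
          using k(1) by (simp add: orbit)
        ultimately have "dist ((F d ^^ nat k) p) q < \<epsilon>" by (simp only:)
        moreover have "(F d ^^ nat k) p \<in> forward_orbit (F d) p" by (auto simp: forward_orbit_def)
        ultimately show "\<exists>y\<in>forward_orbit (F d) p. dist y q < \<epsilon>" by blast
      qed
    qed
  qed
qed

lemma exact_period:
  assumes p: "p \<in> curve d K" and j: "rotation_number d s = of_int j / of_nat q" "coprime j (int q)" "q > 0"
  shows "(F d ^^ n) p = p \<longleftrightarrow> q dvd n"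
proof -
  have "(F d ^^ n) p = p \<longleftrightarrow> (\<exists>m::int. of_int (int n * j) = (of_int (m * int q) :: real))"
    unfolding F_funpow_fixed_iff[OF p] j(1) using j(3) by (simp add: Ints_def image_iff field_simps)
  also have "\<dots> \<longleftrightarrow> int q dvd int n * j"
    unfolding of_int_eq_iff by (auto simp: dvd_def mult.commute)
  also have "\<dots> \<longleftrightarrow> q dvd n"
    using j(2) by (simp add: coprime_commute coprime_dvd_mult_left_iff)
  finally show ?thesis .
qed

end

section \<open>Growth of the two quarter times\<close>

text \<open>Comparison of the integrand \<open>1 / sqrt A\<close> with the elementary \<open>c / sqrt B\<close>, where \<open>c\<close> and \<open>u\<close> stand for
\<open>\<bar>sin \<psi>\<bar>\<close> and \<open>cos \<psi>\<close>. Both are large only where \<open>u\<close> is small, and there the relative error of \<open>B\<close> is of order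
\<open>u\<^sup>2\<close>, which cancels the singularity \<open>1 / u\<close>. So the error is bounded uniformly in \<open>s\<close>.\<close>

lemma inverse_sqrt_diff_bound:
  fixes A B c u :: real
  assumes "A > 0" "B > 0" "u\<^sup>2 / 2 \<le> A" "u\<^sup>2 / 2 \<le> B" "\<bar>A - B\<bar> \<le> 2 * u\<^sup>2 * B"
    and "0 \<le> c" "c \<le> 1" "0 \<le> u" and cu: "u\<^sup>2 = 1 - c\<^sup>2"
  shows "\<bar>1 / sqrt A - c / sqrt B\<bar> \<le> 5"
proof (cases "u = 0")
  case True
  then have "c = 1" "A = B" using assms by (auto simp: power2_eq_1_iff)
  then show ?thesis by simp
next
  case False
  then have u: "u > 0" using assms by simp
  have "u\<^sup>2 \<le> 1" using cu by simp
  then have u1: "u \<le> 1" using power2_le_imp_le[of u 1] by simp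
  have root: "2 / 3 * u \<le> sqrt D" if "u\<^sup>2 / 2 \<le> D" for D
  proof (rule real_le_rsqrt)
    have "4 / 9 * u\<^sup>2 \<le> D" using that zero_le_power2[of u] by linarith
    then show "(2 / 3 * u)\<^sup>2 \<le> D" by (simp add: power_mult_distrib power_divide)
  qed
  have rA: "2 / 3 * u \<le> sqrt A" and rB: "2 / 3 * u \<le> sqrt B" using root assms by auto
  have pos: "sqrt A > 0" "sqrt B > 0" using assms by auto
  have "1 / sqrt A - 1 / sqrt B = (B - A) / (sqrt A * sqrt B * (sqrt A + sqrt B))"
  proof -
    have "(B - A) = (sqrt B - sqrt A) * (sqrt A + sqrt B)"
      using assms by (simp add: algebra_simps)
    then have "(B - A) / (sqrt A * sqrt B * (sqrt A + sqrt B)) = (sqrt B - sqrt A) / (sqrt A * sqrt B)"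
      by (simp only:) (rule nonzero_mult_divide_mult_cancel_right, use pos in linarith)
    also have "\<dots> = 1 / sqrt A - 1 / sqrt B" using pos by (simp add: diff_divide_distrib)
    finally show ?thesis by simp
  qed
  then have "\<bar>1 / sqrt A - 1 / sqrt B\<bar> = \<bar>A - B\<bar> / (sqrt A * sqrt B * (sqrt A + sqrt B))"
    using pos by (simp add: abs_mult abs_minus_commute)
  also have "\<dots> \<le> 2 * u\<^sup>2 * B / (sqrt A * sqrt B * sqrt B)"
    using assms pos by (intro frac_le mult_left_mono) auto
  also have "\<dots> = 2 * u\<^sup>2 / sqrt A" using assms by (simp add: mult.assoc)
  also have "\<dots> \<le> 2 * u\<^sup>2 / (2 / 3 * u)" using rA u pos by (intro divide_left_mono mult_pos_pos) auto
  also have "\<dots> = 3 * u" using u by (simp add: power2_eq_square)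
  finally have 1: "\<bar>1 / sqrt A - 1 / sqrt B\<bar> \<le> 3" using u1 by simp
  have "1 - c \<le> u\<^sup>2" unfolding cu using assms mult_left_le[of c c] by (simp add: power2_eq_square)
  then have "(1 - c) / sqrt B \<le> u\<^sup>2 / (2 / 3 * u)"
    using rB u assms by (intro frac_le) auto
  also have "\<dots> = 3 / 2 * u" using u by (simp add: power2_eq_square)
  finally have "(1 - c) / sqrt B \<le> 3 / 2" using u1 by simp
  moreover have "(1 - c) / sqrt B \<ge> 0" using assms by simp
  moreover have "1 / sqrt A - c / sqrt B = (1 / sqrt A - 1 / sqrt B) + (1 - c) / sqrt B"
    by (simp add: diff_divide_distrib)
  ultimately show ?thesis using 1 by linarith
qed

lemma DERIV_arsinh_cos:
  assumes "\<gamma> > 0" "\<kappa> > 0"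
  shows "((\<lambda>\<psi>. arsinh (sqrt (\<gamma> / \<kappa>) * cos \<psi>) / sqrt \<gamma>) has_real_derivative
    - sin \<psi> / sqrt (\<gamma> * (cos \<psi>)\<^sup>2 + \<kappa>)) (at \<psi>)"
proof -
  let ?g = "sqrt (\<gamma> / \<kappa>)"
  have "((\<lambda>\<psi>. arsinh (?g * cos \<psi>) / sqrt \<gamma>) has_real_derivative
      (1 / sqrt ((?g * cos \<psi>)\<^sup>2 + 1) * (?g * (- sin \<psi>))) / sqrt \<gamma>) (at \<psi>)"
    by (intro DERIV_cdivide DERIV_chain2[OF arsinh_real_has_field_derivative])
       (auto intro!: derivative_eq_intros)
  also have "sqrt ((?g * cos \<psi>)\<^sup>2 + 1) = sqrt (\<gamma> * (cos \<psi>)\<^sup>2 + \<kappa>) / sqrt \<kappa>"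
    using assms by (simp add: power_mult_distrib add_divide_distrib flip: real_sqrt_divide)
  also have "(1 / (sqrt (\<gamma> * (cos \<psi>)\<^sup>2 + \<kappa>) / sqrt \<kappa>) * (?g * (- sin \<psi>))) / sqrt \<gamma>
      = - sin \<psi> / sqrt (\<gamma> * (cos \<psi>)\<^sup>2 + \<kappa>)"
    using assms by (simp add: real_sqrt_divide)
  finally show ?thesis .
qed

lemma has_integral_arsinh_cos:
  assumes "\<gamma> > 0" "\<kappa> > 0" "a \<le> b"
  shows "((\<lambda>\<psi>. - sin \<psi> / sqrt (\<gamma> * (cos \<psi>)\<^sup>2 + \<kappa>)) has_integral
    arsinh (sqrt (\<gamma> / \<kappa>) * cos b) / sqrt \<gamma> - arsinh (sqrt (\<gamma> / \<kappa>) * cos a) / sqrt \<gamma>) {a..b}"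
  using DERIV_arsinh_cos[OF assms(1,2)] assms(3)
  by (intro fundamental_theorem_of_calculus)
     (auto simp: has_real_derivative_iff_has_vector_derivative intro: has_vector_derivative_at_within)

text \<open>The integrals of the elementary comparison functions. Their logarithmic growth comes from the ends
\<open>\<psi> = - pi / 2\<close> and \<open>\<psi> = pi / 2\<close>, where the rescaled discriminant is of order \<open>s\<close> to the power \<open>-4\<close> and \<open>-3\<close>,
respectively.\<close>

definition log_neg :: "real \<Rightarrow> real \<Rightarrow> real" where
  "log_neg d s = arsinh (sqrt ((1 - d / s ^ 3 / 2) / (1 / s\<^sup>2 + d / s ^ 3 / 2)\<^sup>2)) / sqrt (1 - d / s ^ 3 / 2)"

definition log_pos :: "real \<Rightarrow> real \<Rightarrow> real" where
  "log_pos d s = arsinh (sqrt (1 / (2 * (d / s ^ 3) + (1 / s\<^sup>2 + d / s ^ 3 / 2)\<^sup>2)))"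

context oval
begin

abbreviation "\<beta> \<equiv> d / s ^ 3"
abbreviation "\<kappa> \<equiv> (1 / s\<^sup>2 + \<beta> / 2)\<^sup>2"

lemma disc_scaled:
  "disc d s \<psi> = s\<^sup>2 * ((cos \<psi>)\<^sup>2 + \<beta> * (sin \<psi> * (1 + sin \<psi>)) + \<kappa> * (sin \<psi>)\<^sup>2)"
proof -
  have "h = s * (1 / s\<^sup>2 + \<beta> / 2)"
    using s_pos by (simp add: half_gap_def field_simps power2_eq_square power3_eq_cube)
  moreover have "d / s = s\<^sup>2 * \<beta>"
    using s_pos by (simp add: field_simps power2_eq_square power3_eq_cube)
  moreover have "s\<^sup>2 * (cos \<psi>)\<^sup>2 + s\<^sup>2 * b * sin \<psi> * (1 + sin \<psi>) + (s * q)\<^sup>2 * (sin \<psi>)\<^sup>2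
      = s\<^sup>2 * ((cos \<psi>)\<^sup>2 + b * (sin \<psi> * (1 + sin \<psi>)) + q\<^sup>2 * (sin \<psi>)\<^sup>2)" for b q
    by (simp add: power_mult_distrib algebra_simps)
  ultimately show ?thesis unfolding disc_def by (simp only:)
qed

lemma quarter_diff_bound:
  assumes "a \<le> b" "b - a = pi / 2"
    and M: "(M has_integral I) {a..b}"
    and bound: "\<And>\<psi>. \<psi> \<in> {a..b} \<Longrightarrow> \<bar>s / sqrt (disc d s \<psi>) - M \<psi>\<bar> \<le> 5"
  shows "\<bar>s * integral {a..b} (\<lambda>\<psi>. 1 / sqrt (disc d s \<psi>)) - I\<bar> \<le> 8"
proof -
  have "((\<lambda>\<psi>. 1 / sqrt (disc d s \<psi>)) has_integral integral {a..b} (\<lambda>\<psi>. 1 / sqrt (disc d s \<psi>))) {a..b}"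
    by (intro integrable_integral integrable_continuous_real continuous_inverse_sqrt_disc)
  from has_integral_diff[OF has_integral_mult_right[OF this, of s] M]
  have "((\<lambda>\<psi>. s / sqrt (disc d s \<psi>) - M \<psi>) has_integral
      s * integral {a..b} (\<lambda>\<psi>. 1 / sqrt (disc d s \<psi>)) - I) {a..b}" by simp
  from has_integral_bound_real[OF _ finite.emptyI this, of 5] bound assms(1)
  have "\<bar>s * integral {a..b} (\<lambda>\<psi>. 1 / sqrt (disc d s \<psi>)) - I\<bar> \<le> 5 * (b - a)" by auto
  also have "\<dots> \<le> 8" using assms(2) pi_less_4 pi_approx by simp
  finally show ?thesis .
qed

lemma beta_pos: "\<beta> > 0" and kappa_pos: "\<kappa> > 0"
proof -
  show "\<beta> > 0" using s_pos d_pos by simp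
  then have "1 / s\<^sup>2 + \<beta> / 2 > 0" using s_pos by (simp add: add_pos_pos)
  then show "\<kappa> > 0" by simp
qed

lemma scaled_root: "s / sqrt (s\<^sup>2 * A) = 1 / sqrt A"
  using s_pos by (simp add: real_sqrt_mult)

lemma quarter_neg_asymp:
  assumes "\<beta> \<le> 1"
  shows "\<bar>s * quarter_neg d s - log_neg d s\<bar> \<le> 8"
  unfolding quarter_neg_def
proof (rule quarter_diff_bound)
  define \<gamma> where "\<gamma> = 1 - \<beta> / 2"
  have \<gamma>: "\<gamma> \<ge> 1 / 2" "\<gamma> > 0" using assms by (auto simp: \<gamma>_def)
  let ?M = "\<lambda>\<psi>. - sin \<psi> / sqrt (\<gamma> * (cos \<psi>)\<^sup>2 + \<kappa>)"
  have "(?M has_integral arsinh (sqrt (\<gamma> / \<kappa>) * cos 0) / sqrt \<gamma>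
      - arsinh (sqrt (\<gamma> / \<kappa>) * cos (- (pi / 2))) / sqrt \<gamma>) {- (pi / 2)..0}"
    using \<gamma> kappa_pos by (intro has_integral_arsinh_cos) auto
  then show "(?M has_integral log_neg d s) {- (pi / 2)..0}"
    by (simp add: log_neg_def \<gamma>_def)
  fix \<psi> assume \<psi>: "\<psi> \<in> {- (pi / 2)..0}"
  define c where "c = - sin \<psi>"
  define u where "u = cos \<psi>"
  have u: "u \<ge> 0" unfolding u_def using \<psi> by (intro cos_ge_zero) auto
  have c: "0 \<le> c" "c \<le> 1" using \<psi> sin_ge_zero[of "- \<psi>"] pi_gt_zero by (auto simp: c_def)
  have cu: "u\<^sup>2 = 1 - c\<^sup>2" by (simp add: u_def c_def cos_squared_eq)
  let ?A = "u\<^sup>2 - \<beta> * (c * (1 - c)) + \<kappa> * c\<^sup>2" and ?B = "\<gamma> * u\<^sup>2 + \<kappa>"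
  have "c * (1 - c) \<le> u\<^sup>2 / 2"
    unfolding cu using zero_le_power2[of "1 - c"] by (simp add: power2_eq_square algebra_simps)
  then have "\<beta> * (c * (1 - c)) \<le> 1 * (u\<^sup>2 / 2)"
    using assms beta_pos c by (intro mult_mono) auto
  moreover have "\<kappa> * c\<^sup>2 \<ge> 0" by simp
  ultimately have A: "u\<^sup>2 / 2 \<le> ?A" by linarith
  have "1 / 2 * u\<^sup>2 \<le> \<gamma> * u\<^sup>2" using \<gamma> by (intro mult_right_mono) auto
  then have B: "u\<^sup>2 / 2 + \<kappa> \<le> ?B" by simp
  have disc: "disc d s \<psi> = s\<^sup>2 * ?A"
    unfolding disc_scaled c_def u_def by (simp add: algebra_simps)
  have "?A > 0" using disc_den_pos(1)[of \<psi>] unfolding disc using s_pos by (simp add: zero_less_mult_iff)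
  have "1 - c \<le> u\<^sup>2" unfolding cu using c mult_left_le[of c c] by (simp add: power2_eq_square)
  then have "(1 - c)\<^sup>2 \<le> (u\<^sup>2)\<^sup>2" using c by (intro power_mono) auto
  then have "\<beta> * (1 - c)\<^sup>2 \<le> 1 * (u\<^sup>2)\<^sup>2" using assms beta_pos by (intro mult_mono) auto
  moreover have "\<beta> * (1 - c)\<^sup>2 \<ge> 0"
    by (intro mult_nonneg_nonneg less_imp_le[OF beta_pos] zero_le_power2)
  moreover have "?A - ?B = \<beta> * (1 - c)\<^sup>2 / 2 - \<kappa> * u\<^sup>2"
    unfolding \<gamma>_def cu by (simp add: power2_eq_square algebra_simps add_divide_distrib diff_divide_distrib)
  moreover have "\<kappa> * u\<^sup>2 \<ge> 0" by simp
  moreover have "\<bar>z\<bar> \<le> v / 2 + y" if "x \<le> 1 * v" "0 \<le> x" "z = x / 2 - y" "0 \<le> y" for v x y z :: real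
    using that by linarith
  ultimately have "\<bar>?A - ?B\<bar> \<le> (u\<^sup>2)\<^sup>2 / 2 + \<kappa> * u\<^sup>2" by blast
  also have "(u\<^sup>2)\<^sup>2 / 2 + \<kappa> * u\<^sup>2 = u\<^sup>2 * (u\<^sup>2 / 2 + \<kappa>)"
    by (simp only: power2_eq_square[of "u\<^sup>2"] distrib_left mult.commute times_divide_eq_right)
  also have "\<dots> \<le> u\<^sup>2 * ?B" using B by (intro mult_left_mono) auto
  also have "u\<^sup>2 * ?B \<le> 2 * u\<^sup>2 * ?B"
  proof -
    have "?B \<ge> 0" using B kappa_pos zero_le_power2[of u] by linarith
    then show ?thesis by (intro mult_right_mono) auto
  qed
  finally have "\<bar>1 / sqrt ?A - c / sqrt ?B\<bar> \<le> 5"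
    using \<open>?A > 0\<close> A B kappa_pos c u cu zero_le_power2[of u]
    by (intro inverse_sqrt_diff_bound[where u = u]) linarith+
  then show "\<bar>s / sqrt (disc d s \<psi>) - ?M \<psi>\<bar> \<le> 5"
    unfolding disc scaled_root by (simp add: c_def u_def)
qed auto

lemma quarter_pos_asymp: "\<bar>s * quarter_pos d s - log_pos d s\<bar> \<le> 8"
  unfolding quarter_pos_def
proof (rule quarter_diff_bound)
  define E where "E = 2 * \<beta> + \<kappa>"
  have E: "E > 0" using beta_pos kappa_pos by (simp add: E_def add_pos_pos)
  let ?M = "\<lambda>\<psi>. sin \<psi> / sqrt ((cos \<psi>)\<^sup>2 + E)"
  have "((\<lambda>\<psi>. - sin \<psi> / sqrt (1 * (cos \<psi>)\<^sup>2 + E)) has_integral arsinh (sqrt (1 / E) * cos (pi / 2)) / sqrt 1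
      - arsinh (sqrt (1 / E) * cos 0) / sqrt 1) {0..pi / 2}"
    using E by (intro has_integral_arsinh_cos) auto
  from has_integral_neg[OF this] show "(?M has_integral log_pos d s) {0..pi / 2}"
    by (simp add: log_pos_def E_def)
  fix \<psi> assume \<psi>: "\<psi> \<in> {0..pi / 2}"
  define c where "c = sin \<psi>"
  define u where "u = cos \<psi>"
  have u: "u \<ge> 0" unfolding u_def using \<psi> by (intro cos_ge_zero) auto
  have c: "0 \<le> c" "c \<le> 1" using \<psi> sin_ge_zero[of "\<psi>"] pi_gt_zero by (auto simp: c_def)
  have cu: "u\<^sup>2 = 1 - c\<^sup>2" by (simp add: u_def c_def cos_squared_eq)
  let ?A = "u\<^sup>2 + \<beta> * (c * (1 + c)) + \<kappa> * c\<^sup>2" and ?B = "u\<^sup>2 + E"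
  have disc: "disc d s \<psi> = s\<^sup>2 * ?A"
    unfolding disc_scaled c_def u_def by (simp add: algebra_simps)
  have "?A > 0" using disc_den_pos(1)[of \<psi>] unfolding disc using s_pos by (simp add: zero_less_mult_iff)
  have nn: "\<beta> * (c * (1 + c)) \<ge> 0" "\<kappa> * c\<^sup>2 \<ge> 0"
    using c mult_nonneg_nonneg[OF less_imp_le[OF beta_pos], of "c * (1 + c)"] by auto
  have c2: "c\<^sup>2 \<le> c" using c mult_left_le[of c c] by (simp add: power2_eq_square)
  have "0 \<le> 2 - c - c\<^sup>2" using c c2 by linarith
  moreover have "2 * c\<^sup>2 \<le> 1 + c" using c c2 by linarith
  then have "2 - c - c\<^sup>2 \<le> 3 * u\<^sup>2" unfolding cu by (simp add: algebra_simps)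
  ultimately have "0 \<le> \<beta> * (2 - c - c\<^sup>2) \<and> \<beta> * (2 - c - c\<^sup>2) \<le> \<beta> * (3 * u\<^sup>2)"
    by (intro conjI mult_nonneg_nonneg mult_left_mono less_imp_le[OF beta_pos])
  then have "0 \<le> \<beta> * (2 - c - c\<^sup>2)" "\<beta> * (2 - c - c\<^sup>2) \<le> 3 * (\<beta> * u\<^sup>2)"
    by (simp_all only: mult.left_commute)
  moreover have "u\<^sup>2 + (2 * b + k) - (u\<^sup>2 + b * (c * (1 + c)) + k * c\<^sup>2)
      = b * (2 - c - c\<^sup>2) + k * u\<^sup>2" for b k
    unfolding cu by (simp add: power2_eq_square algebra_simps)
  then have "?B - ?A = \<beta> * (2 - c - c\<^sup>2) + \<kappa> * u\<^sup>2" unfolding E_def .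
  moreover have "\<kappa> * u\<^sup>2 \<ge> 0" "\<beta> * u\<^sup>2 \<ge> 0"
    by (intro mult_nonneg_nonneg less_imp_le[OF beta_pos] zero_le_power2)+
  moreover have "\<bar>a - b\<bar> \<le> 4 * y + 2 * z"
    if "0 \<le> x" "x \<le> 3 * y" "b - a = x + z" "z \<ge> 0" "y \<ge> 0" for a b x y z :: real
    using that by linarith
  ultimately have "\<bar>?A - ?B\<bar> \<le> 4 * (\<beta> * u\<^sup>2) + 2 * (\<kappa> * u\<^sup>2)" by blast
  also have "\<dots> = 2 * u\<^sup>2 * E"
  proof -
    have "4 * (b * u\<^sup>2) + 2 * (k * u\<^sup>2) = 2 * u\<^sup>2 * (2 * b + k)" for b k
      by (simp add: algebra_simps)
    then show ?thesis unfolding E_def .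
  qed
  also have "\<dots> \<le> 2 * u\<^sup>2 * ?B" by (intro mult_left_mono) auto
  finally have "\<bar>1 / sqrt ?A - c / sqrt ?B\<bar> \<le> 5"
    using \<open>?A > 0\<close> nn E c u cu zero_le_power2[of u]
    by (intro inverse_sqrt_diff_bound[where u = u]) linarith+
  then show "\<bar>s / sqrt (disc d s \<psi>) - ?M \<psi>\<bar> \<le> 5"
    unfolding disc scaled_root by (simp add: c_def u_def)
qed auto

end

text \<open>Each comparison integral grows like half the logarithm of the reciprocal of the rescaled discriminant at the
respective end. There the discriminant decays like \<open>s\<close> to the power \<open>-4\<close> and \<open>-3\<close>, so the ratio tends to \<open>4 / 3\<close>.\<close>

lemma quarter_ratio_limit:
  assumes d: "d > 0" and eq: "\<And>s. s > ell d \<Longrightarrow> quarter_neg d s = c * quarter_pos d s"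
  shows "c = 4 / 3"
proof -
  have lim: "((\<lambda>s. log_neg d s / log_pos d s) \<longlongrightarrow> 4 / 3) at_top"
    unfolding log_neg_def log_pos_def arsinh_real_def using d by real_asymp
  have inf: "filterlim (\<lambda>s. log_pos d s) at_top at_top"
    unfolding log_pos_def arsinh_real_def using d by real_asymp
  have small: "\<forall>\<^sub>F s in at_top. d / s ^ 3 \<le> 1"
    using d by real_asymp
  have bound: "\<forall>\<^sub>F s in at_top. \<bar>log_neg d s - c * log_pos d s\<bar> \<le> 8 + \<bar>c\<bar> * 8"
    using small eventually_gt_at_top[of "ell d"]
  proof eventually_elim
    case (elim s)
    interpret oval d s using d elim by unfold_locales
    have "log_neg d s - c * log_pos d s = c * (s * quarter_pos d s - log_pos d s) - (s * quarter_neg d s - log_neg d s)"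
      using eq[OF elim(2)] by (simp add: algebra_simps)
    moreover have "\<bar>c * (s * quarter_pos d s - log_pos d s)\<bar> \<le> \<bar>c\<bar> * 8"
      unfolding abs_mult using quarter_pos_asymp by (intro mult_left_mono) auto
    ultimately show ?case using quarter_neg_asymp[OF elim(1)] by linarith
  qed
  have "((\<lambda>s. (log_neg d s - c * log_pos d s) / log_pos d s) \<longlongrightarrow> 0) at_top"
  proof (rule Lim_null_comparison)
    show "\<forall>\<^sub>F s in at_top. norm ((log_neg d s - c * log_pos d s) / log_pos d s) \<le> (8 + \<bar>c\<bar> * 8) / log_pos d s"
      using bound filterlim_at_top_dense[THEN iffD1, OF inf, rule_format, of 0]
      by eventually_elim (auto intro: divide_right_mono)
    show "((\<lambda>s. (8 + \<bar>c\<bar> * 8) / log_pos d s) \<longlongrightarrow> 0) at_top"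
      by (intro tendsto_divide_0[OF tendsto_const] filterlim_at_top_imp_at_infinity inf)
  qed
  moreover have "((\<lambda>s. (log_neg d s - c * log_pos d s) / log_pos d s) \<longlongrightarrow> 4 / 3 - c) at_top"
  proof (rule Lim_transform_eventually[OF tendsto_diff[OF lim tendsto_const]])
    show "\<forall>\<^sub>F s in at_top. log_neg d s / log_pos d s - c = (log_neg d s - c * log_pos d s) / log_pos d s"
      using filterlim_at_top_dense[THEN iffD1, OF inf, rule_format, of 0]
      by eventually_elim (simp add: diff_divide_distrib)
  qed
  ultimately have "4 / 3 - c = 0" using tendsto_unique trivial_limit_at_top_linorder by blast
  then show ?thesis by simp
qed

section \<open>Analytic dependence on the level\<close>

definition complex_disc :: "real \<Rightarrow> complex \<Rightarrow> real \<Rightarrow> complex" where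
  "complex_disc d z \<psi> = z\<^sup>2 * (of_real (cos \<psi>))\<^sup>2 + of_real d / z * of_real (sin \<psi> * (1 + sin \<psi>))
     + (1 / z + of_real d / (2 * z\<^sup>2))\<^sup>2 * (of_real (sin \<psi>))\<^sup>2"

lemma complex_disc_of_real: "complex_disc d (of_real s) \<psi> = of_real (disc d s \<psi>)"
  by (simp add: complex_disc_def disc_def half_gap_def mult.assoc)

text \<open>By compactness of the interval the discriminant keeps positive real part for all complex parameters near a real
one, so that the integral stays meaningful and can be differentiated under the integral sign.\<close>

lemma disc_integral_extends:
  assumes d: "d > 0" and s: "s > ell d" and ab: "a \<le> b"
  shows "\<exists>r>0. \<exists>f. f holomorphic_on ball (complex_of_real s) r \<and>
    (\<forall>y. \<bar>y - s\<bar> < r \<longrightarrow> ell d < y \<and> f (of_real y) = of_real (integral {a..b} (\<lambda>\<psi>. 1 / sqrt (disc d y \<psi>))))"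
proof -
  interpret oval d s using d s by unfold_locales
  have "continuous_on ((- {0}) \<times> UNIV) (\<lambda>z. Re (complex_disc d (fst z) (snd z)))"
    unfolding complex_disc_def by (auto intro!: continuous_intros)
  then have "open (((- {0}) \<times> UNIV) \<inter> (\<lambda>z. Re (complex_disc d (fst z) (snd z))) -` {0<..})"
    by (intro continuous_open_preimage) (auto intro: open_Times)
  then obtain V where V: "open V" "V = ((- {0}) \<times> UNIV) \<inter> (\<lambda>z. Re (complex_disc d (fst z) (snd z))) -` {0<..}"
    by blast
  have "{complex_of_real s} \<times> {a..b} \<subseteq> V"
    using disc_den_pos(1) s_pos by (auto simp: V complex_disc_of_real)
  from Elementary_Topology.tube_lemma[OF compact_Icc V(1) this]
  obtain X where X: "complex_of_real s \<in> X" "open X" "X \<times> {a..b} \<subseteq> V" by (elim exE conjE)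
  then obtain r where r: "r > 0" "ball (complex_of_real s) r \<subseteq> X"
    using open_contains_ball by blast
  define r' where "r' = min r (s - ell d)"
  have r': "r' > 0" "r' \<le> r" using r s by (auto simp: r'_def)
  let ?U = "ball (complex_of_real s) r'"
  have U: "z \<noteq> 0" "complex_disc d z \<psi> \<notin> \<real>\<^sub>\<le>\<^sub>0" "complex_disc d z \<psi> \<noteq> 0" if "z \<in> ?U" "\<psi> \<in> {a..b}" for z \<psi>
  proof -
    have "(z, \<psi>) \<in> V" using that r r' X by (auto simp: subset_iff)
    then show "z \<noteq> 0" "complex_disc d z \<psi> \<notin> \<real>\<^sub>\<le>\<^sub>0" "complex_disc d z \<psi> \<noteq> 0" by (auto simp: V complex_nonpos_Reals_iff)
  qed
  define D where "D z \<psi> = 2 * z * (of_real (cos \<psi>))\<^sup>2 - of_real d / z\<^sup>2 * of_real (sin \<psi> * (1 + sin \<psi>))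
     - 2 * (1 / z + of_real d / (2 * z\<^sup>2)) * (1 / z\<^sup>2 + of_real d / z ^ 3) * (of_real (sin \<psi>))\<^sup>2" for z :: complex and \<psi>
  define f where "f z = integral (cbox a b) (\<lambda>\<psi>. 1 / csqrt (complex_disc d z \<psi>))" for z
  have cont: "continuous_on (?U \<times> {a..b}) (\<lambda>(z, \<psi>). complex_disc d z \<psi>)"
    unfolding complex_disc_def case_prod_unfold using U
    by (auto intro!: continuous_intros)
  have contq: "continuous_on (?U \<times> {a..b}) (\<lambda>(z, \<psi>). csqrt (complex_disc d z \<psi>))"
  proof -
    have "(\<lambda>(z, \<psi>). complex_disc d z \<psi>) ` (?U \<times> {a..b}) \<subseteq> - \<real>\<^sub>\<le>\<^sub>0"
      using U by (auto simp del: mem_ball)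
    from continuous_on_compose2[OF continuous_on_csqrt cont this] show ?thesis
      by (simp add: case_prod_unfold)
  qed
  have "f holomorphic_on ?U"
    unfolding f_def
  proof (rule leibniz_rule_holomorphic)
    show "((\<lambda>z. 1 / csqrt (complex_disc d z \<psi>)) has_field_derivative
        - D z \<psi> / (2 * csqrt (complex_disc d z \<psi>) ^ 3)) (at z within ?U)"
      if "z \<in> ?U" "\<psi> \<in> cbox a b" for z \<psi>
    proof -
      have z: "z \<noteq> 0" "complex_disc d z \<psi> \<notin> \<real>\<^sub>\<le>\<^sub>0" using U that by auto
      then have q: "csqrt (complex_disc d z \<psi>) \<noteq> 0" by auto
      have "((\<lambda>z. complex_disc d z \<psi>) has_field_derivative D z \<psi>) (at z within ?U)"
        unfolding complex_disc_def D_def using z(1)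
        by (auto intro!: derivative_eq_intros simp: field_simps power2_eq_square power3_eq_cube)
      from has_field_derivative_csqrt'[OF this z(2)]
      have "((\<lambda>z. csqrt (complex_disc d z \<psi>)) has_field_derivative
          D z \<psi> / (2 * csqrt (complex_disc d z \<psi>))) (at z within ?U)" .
      from DERIV_inverse_fun[OF this q] q show ?thesis
        by (simp add: field_simps power3_eq_cube)
    qed
    show "(\<lambda>\<psi>. 1 / csqrt (complex_disc d z \<psi>)) integrable_on cbox a b" if "z \<in> ?U" for z
    proof -
      have "continuous_on {a..b} (\<lambda>\<psi>. csqrt (complex_disc d z \<psi>))"
      proof -
        have "Pair z ` {a..b} \<subseteq> ?U \<times> {a..b}" using that by auto
        moreover have "continuous_on {a..b} (Pair z)" by (intro continuous_intros)
        ultimately show ?thesis using continuous_on_compose2[OF contq, of "{a..b}" "Pair z"] by simp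
      qed
      moreover have "csqrt (complex_disc d z \<psi>) \<noteq> 0" if "\<psi> \<in> {a..b}" for \<psi>
        using U(2)[OF \<open>z \<in> ?U\<close> that] by auto
      ultimately show ?thesis
        by (auto intro!: integrable_continuous_real continuous_on_divide continuous_on_const)
    qed
    have "continuous_on (?U \<times> {a..b}) (\<lambda>(z, \<psi>). D z \<psi>)"
      unfolding D_def case_prod_unfold using U by (auto intro!: continuous_intros)
    with contq show "continuous_on (?U \<times> cbox a b) (\<lambda>(z, \<psi>). - D z \<psi> / (2 * csqrt (complex_disc d z \<psi>) ^ 3))"
      unfolding case_prod_unfold using U by (auto intro!: continuous_intros)
  qed simp
  moreover have "ell d < y \<and> f (of_real y) = of_real (integral {a..b} (\<lambda>\<psi>. 1 / sqrt (disc d y \<psi>)))"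
    if y: "\<bar>y - s\<bar> < r'" for y
  proof -
    have "ell d < y" using y by (auto simp: r'_def)
    then interpret y: oval d y using d by unfold_locales
    have "((\<lambda>\<psi>. 1 / sqrt (disc d y \<psi>)) has_integral integral {a..b} (\<lambda>\<psi>. 1 / sqrt (disc d y \<psi>))) {a..b}"
      by (intro integrable_integral integrable_continuous_real y.continuous_inverse_sqrt_disc)
    note int = has_integral_of_real[OF this, where 'b = complex]
    have "1 / csqrt (complex_disc d (of_real y) \<psi>) = of_real (1 / sqrt (disc d y \<psi>))" for \<psi>
      unfolding complex_disc_of_real using of_real_sqrt[OF less_imp_le[OF y.disc_den_pos(1)[of \<psi>]]]
      by (simp only: of_real_divide of_real_1)
    with int have "((\<lambda>\<psi>. 1 / csqrt (complex_disc d (of_real y) \<psi>)) has_integral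
        of_real (integral {a..b} (\<lambda>\<psi>. 1 / sqrt (disc d y \<psi>)))) {a..b}"
      by (simp only:)
    then show ?thesis using \<open>ell d < y\<close> by (simp add: f_def integral_unique)
  qed
  ultimately show ?thesis using r' by blast
qed

text \<open>Vanishing near a point propagates to the whole domain of a local holomorphic extension, and
the half-line is connected.\<close>

lemma real_identity_theorem:
  fixes h :: "real \<Rightarrow> real"
  assumes ext: "\<And>x. x > l \<Longrightarrow> \<exists>r>0. \<exists>f. f holomorphic_on ball (complex_of_real x) r \<and>
      (\<forall>y. \<bar>y - x\<bar> < r \<longrightarrow> l < y \<and> f (of_real y) = of_real (h y))"
    and pq: "l < p" "p < q" and zero: "\<And>x. p < x \<Longrightarrow> x < q \<Longrightarrow> h x = 0" and x: "x > l"
  shows "h x = 0"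
proof -
  define P where "P x \<longleftrightarrow> (\<exists>\<epsilon>>0. \<forall>y. \<bar>y - x\<bar> < \<epsilon> \<longrightarrow> h y = 0)" for x
  have "P x"
  proof (rule connected_induction_simple[of "{l<..}" "(p + q) / 2"])
    show "connected {l<..}" by simp
    show "(p + q) / 2 \<in> {l<..}" "x \<in> {l<..}" using pq x by auto
    show "P ((p + q) / 2)"
      unfolding P_def using pq zero
      by (intro exI[of _ "(q - p) / 2"]) (auto simp: abs_less_iff field_simps)
  next
    fix a assume "a \<in> {l<..}"
    then obtain r f where r: "r > 0" and f: "f holomorphic_on ball (complex_of_real a) r"
      and fh: "\<And>y. \<bar>y - a\<bar> < r \<Longrightarrow> l < y \<and> f (of_real y) = of_real (h y)"
      using ext[of a] by auto
    show "\<exists>T. openin (top_of_set {l<..}) T \<and> a \<in> T \<and> (\<forall>x\<in>T. \<forall>y\<in>T. P x \<longrightarrow> P y)"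
    proof (intro exI[of _ "ball a r"] conjI ballI impI)
      have "ball a r \<subseteq> {l<..}" using fh by (auto simp: dist_real_def abs_minus_commute)
      then show "openin (top_of_set {l<..}) (ball a r)"
        by (simp add: open_subset)
      show "a \<in> ball a r" using r by simp
      fix x y assume x: "x \<in> ball a r" and y: "y \<in> ball a r" and "P x"
      then obtain \<epsilon> where \<epsilon>: "\<epsilon> > 0" "\<And>y. \<bar>y - x\<bar> < \<epsilon> \<Longrightarrow> h y = 0" by (auto simp: P_def)
      define \<delta> where "\<delta> = min \<epsilon> (r - \<bar>x - a\<bar>)"
      have \<delta>: "\<delta> > 0" using \<epsilon> x by (auto simp: \<delta>_def dist_real_def abs_minus_commute)
      let ?Z = "complex_of_real ` ball x \<delta>"
      have inr: "\<bar>z - a\<bar> < r" if "z \<in> ball x \<delta>" for z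
        using that by (auto simp: \<delta>_def dist_real_def)
      have "x islimpt ball x \<delta>"
        using \<delta> by (simp add: islimpt_ball)
      then have lim: "complex_of_real x islimpt ?Z"
        by (intro islimpt_isCont_image[where f = complex_of_real]) (auto simp: eventually_at_filter)
      have dist_c: "dist (complex_of_real a) (of_real z) = \<bar>z - a\<bar>" for z
        by (metis abs_minus_commute dist_norm norm_of_real of_real_diff)
      have "f w = 0" if "w \<in> ball (complex_of_real a) r" for w
      proof (rule analytic_continuation[OF f open_ball connected_ball _ _ lim _ that])
        show "?Z \<subseteq> ball (complex_of_real a) r"
          using inr by (auto simp: dist_real_def abs_minus_commute)
        show "complex_of_real x \<in> ball (complex_of_real a) r"
          using x by (auto simp: dist_c dist_real_def abs_minus_commute)
        fix z assume "z \<in> ?Z"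
        then obtain t where t: "z = of_real t" "t \<in> ball x \<delta>" by auto
        then have "\<bar>t - x\<bar> < \<epsilon>" by (auto simp: \<delta>_def dist_real_def abs_minus_commute)
        then show "f z = 0" using fh[OF inr[OF t(2)]] \<epsilon>(2) t by simp
      qed
      then have all: "h z = 0" if "\<bar>z - a\<bar> < r" for z
      proof -
        have "complex_of_real z \<in> ball (complex_of_real a) r" using that by (simp only: mem_ball dist_c)
        then have "f (of_real z) = 0" by (rule \<open>\<And>w. w \<in> ball (complex_of_real a) r \<Longrightarrow> f w = 0\<close>)
        then show ?thesis using fh[OF that] by simp
      qed
      show "P y"
        unfolding P_def using y all
        by (intro exI[of _ "r - \<bar>y - a\<bar>"]) (auto simp: dist_real_def abs_minus_commute)
    qed
  qed
  then show ?thesis unfolding P_def by auto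
qed

lemma quarter_ratio_propagates:
  assumes d: "d > 0" and pq: "ell d < p" "p < q"
    and eq: "\<And>s. p < s \<Longrightarrow> s < q \<Longrightarrow> quarter_neg d s = c * quarter_pos d s" and s: "s > ell d"
  shows "quarter_neg d s = c * quarter_pos d s"
proof -
  define h where "h s = quarter_neg d s - c * quarter_pos d s" for s
  have "h s = 0"
  proof (rule real_identity_theorem[where l = "ell d" and h = h, OF _ pq _ s])
    show "h x = 0" if "p < x" "x < q" for x using eq that by (simp add: h_def)
    fix x assume x: "x > ell d"
    have i: "- (pi / 2) \<le> 0" "0 \<le> pi / 2" by auto
    obtain r f where f: "r > 0" "f holomorphic_on ball (complex_of_real x) r"
      "\<forall>y. \<bar>y - x\<bar> < r \<longrightarrow> ell d < y \<and> f (of_real y) = of_real (quarter_neg d y)"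
      using disc_integral_extends[OF d x i(1)] unfolding quarter_neg_def by blast
    obtain r' g where g: "r' > 0" "g holomorphic_on ball (complex_of_real x) r'"
      "\<forall>y. \<bar>y - x\<bar> < r' \<longrightarrow> ell d < y \<and> g (of_real y) = of_real (quarter_pos d y)"
      using disc_integral_extends[OF d x i(2)] unfolding quarter_pos_def by blast
    have "f holomorphic_on ball (complex_of_real x) (min r r')" "g holomorphic_on ball (complex_of_real x) (min r r')"
      using f(2) g(2) by (auto elim!: holomorphic_on_subset)
    then show "\<exists>r>0. \<exists>f. f holomorphic_on ball (complex_of_real x) r \<and>
        (\<forall>y. \<bar>y - x\<bar> < r \<longrightarrow> ell d < y \<and> f (of_real y) = of_real (h y))"
      using f(1,3) g(1,3)
      by (intro exI[of _ "min r r'"] conjI exI[of _ "\<lambda>z. f z - of_real c * g z"])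
         (auto intro!: holomorphic_intros simp: h_def)
  qed
  then show ?thesis by (simp add: h_def)
qed

lemma continuous_quarter:
  assumes d: "d > 0"
  shows "continuous_on {ell d<..} (quarter_neg d)" "continuous_on {ell d<..} (quarter_pos d)"
proof -
  have "continuous_on {ell d<..} (\<lambda>s. integral {a..b} (\<lambda>\<psi>. 1 / sqrt (disc d s \<psi>)))" if ab: "a \<le> b" for a b
  proof (intro continuous_at_imp_continuous_on ballI)
    fix s assume "s \<in> {ell d<..}"
    then obtain r f where r: "r > 0" "f holomorphic_on ball (complex_of_real s) r"
      "\<And>y. \<bar>y - s\<bar> < r \<Longrightarrow> f (of_real y) = of_real (integral {a..b} (\<lambda>\<psi>. 1 / sqrt (disc d y \<psi>)))"
      using disc_integral_extends[OF d _ ab, of s] by auto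
    then have "isCont f (of_real s)"
      using holomorphic_on_imp_continuous_on continuous_on_interior interior_open by fastforce
    then have "isCont (\<lambda>y. f (of_real y)) s"
      by (intro isCont_o2[where g = f and f = of_real] isCont_of_real continuous_ident)
    then have "isCont (\<lambda>y. Re (f (of_real y))) s"
      unfolding isCont_def by (rule tendsto_Re)
    moreover have ev: "\<forall>\<^sub>F y in nhds s. Re (f (of_real y)) = integral {a..b} (\<lambda>\<psi>. 1 / sqrt (disc d y \<psi>))"
      unfolding eventually_nhds_metric using r(1,3) by (intro exI[of _ r]) (simp add: dist_real_def)
    ultimately show "isCont (\<lambda>s. integral {a..b} (\<lambda>\<psi>. 1 / sqrt (disc d s \<psi>))) s"
      unfolding isCont_cong[OF ev] by blast
  qed
  then show "continuous_on {ell d<..} (quarter_neg d)" "continuous_on {ell d<..} (quarter_pos d)"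
    unfolding quarter_neg_def[abs_def] quarter_pos_def[abs_def] by auto
qed

section \<open>The rotation number is nowhere locally constant\<close>

text \<open>Let \<open>u\<close> be the orbit of the recurrence that starts with \<open>u\<^sub>0 = u\<^sub>1 = s\<close>. The recurrence can be
read backwards, so \<open>u\<^sub>7 = u\<^sub>8 = s\<close> gives \<open>u\<^sub>6 = u\<^sub>2\<close> and \<open>u\<^sub>5 = u\<^sub>3\<close>, whence \<open>u\<^sub>3\<^sup>2 = 1 + d / u\<^sub>4\<close>. The conclusion is
this equation with cleared denominators; up to powers of \<open>s\<close>, the numbers \<open>A\<close>, \<open>B\<close> and \<open>C\<close> are the
numerators of \<open>u\<^sub>2\<close>, \<open>u\<^sub>3\<close> and \<open>u\<^sub>4\<close>.\<close>

lemma seventh_iterate_diagonal: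
  fixes s :: real
  assumes d: "d > 0" and s: "s > 0" and fix7: "(lyness d ^^ 7) (s, s) = (s, s)"
  defines "A \<equiv> s + d" and "B \<equiv> s + d + d * s\<^sup>2" and "C \<equiv> d + (1 + d\<^sup>2) * s + 2 * d * s\<^sup>2"
  shows "B\<^sup>2 * C = s\<^sup>2 * A\<^sup>2 * C + d * A ^ 3 * B"
proof -
  define u where "u n = fst ((lyness d ^^ n) (s, s))" for n
  have it: "(lyness d ^^ n) (s, s) = (u n, u (Suc n))" for n
    by (induction n) (simp_all add: u_def lyness_def case_prod_unfold)
  have rec: "u (Suc (Suc n)) = (u (Suc n) + d) / (u n * u (Suc n))" for n
    using it[of "Suc n"] it[of n] by (simp add: lyness_def)
  have u01: "u 0 = s" "u 1 = s" using it[of 0] by auto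
  have pos: "u n > 0 \<and> u (Suc n) > 0" for n
    by (induction n) (use s d u01 rec in \<open>auto simp: add_pos_pos\<close>)
  have u78: "u 7 = s" "u 8 = s" using fix7 it[of 7] by auto
  have r: "u (Suc (Suc n)) * (u n * u (Suc n)) = u (Suc n) + d" for n
    using rec[of n] pos[of n] by simp
  have mirror: "u n = u m" if "u (Suc (Suc n)) = u k" "u (Suc n) = u (Suc k)" "u m = u (Suc (Suc k))" for n k m
  proof -
    have "u n = (u (Suc n) + d) / (u (Suc n) * u (Suc (Suc n)))"
      using r[of n] pos[of n] pos[of "Suc n"] by (simp add: field_simps)
    also have "\<dots> = u (Suc (Suc k))" using that rec[of k] by (simp add: mult.commute)
    finally show ?thesis using that by simp
  qed
  have "u 6 = u 2" using mirror[of 6 0 2] u01 u78 by (simp add: numeral_eq_Suc)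
  moreover have "u 5 = u 3" using mirror[of 5 1 3] u01 u78 \<open>u 6 = u 2\<close> by (simp add: numeral_eq_Suc)
  ultimately have key: "u 3 * (u 3 * u 4) = u 4 + d"
    using r[of 3] by (simp add: numeral_eq_Suc mult.commute)
  have A: "A > 0" "B > 0" using s d by (auto simp: A_def B_def add_pos_pos)
  have u2: "u 2 = A / s\<^sup>2" using rec[of 0] u01 by (simp add: A_def numeral_eq_Suc power2_eq_square)
  have u3: "u 3 = B / (s * A)"
  proof -
    have "u 3 = (u 2 + d) / (s * u 2)" using rec[of 1] u01 by (simp add: numeral_eq_Suc)
    also have "\<dots> = (A + d * s\<^sup>2) / (s * A)" unfolding u2 using s A by (simp add: field_simps)
    finally show ?thesis by (simp add: A_def B_def)
  qed
  have u4: "u 4 = s\<^sup>2 * C / (A * B)"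
  proof -
    have "u 4 = (u 3 + d) / (u 2 * u 3)" using rec[of 2] by (simp add: numeral_eq_Suc)
    also have "\<dots> = s\<^sup>2 * (B + d * s * A) / (A * B)"
      unfolding u2 u3 using s A by (simp add: field_simps power2_eq_square)
    also have "B + d * s * A = C" by (simp add: A_def B_def C_def algebra_simps power2_eq_square)
    finally show ?thesis .
  qed
  have "B * C / A ^ 3 = s\<^sup>2 * C / (A * B) + d"
    using key unfolding u3 u4 using s A by (simp add: field_simps power2_eq_square power3_eq_cube)
  then have "B * C / A ^ 3 * (A ^ 3 * B) = (s\<^sup>2 * C / (A * B) + d) * (A ^ 3 * B)" by simp
  moreover have "B * C / A ^ 3 * (A ^ 3 * B) = B\<^sup>2 * C" using A by (simp add: power2_eq_square)
  moreover have "(s\<^sup>2 * C / (A * B) + d) * (A ^ 3 * B) = s\<^sup>2 * A\<^sup>2 * C + d * A ^ 3 * B"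
    using A by (simp add: field_simps power2_eq_square power3_eq_cube)
  ultimately show ?thesis by simp
qed

text \<open>The polynomial condition would hold for infinitely many \<open>s\<close>, hence identically. At \<open>s = 0\<close> this leaves only
\<open>d = 1\<close>, and at \<open>s = 1\<close> it fails for \<open>d = 1\<close>.\<close>

lemma not_seven_periodic:
  assumes d: "d > 0" and all: "\<And>s. s > ell d \<Longrightarrow> (lyness d ^^ 7) (s, s) = (s, s)"
  shows False
proof -
  define A where "A = [:d, 1:]"
  define B where "B = [:d, 1, d:]"
  define C where "C = [:d, 1 + d\<^sup>2, 2 * d:]"
  define P where "P = B\<^sup>2 * C - [:0, 0, 1:] * A\<^sup>2 * C - smult d (A ^ 3 * B)"
  have ev: "poly P s = (s + d + d * s\<^sup>2)\<^sup>2 * (d + (1 + d\<^sup>2) * s + 2 * d * s\<^sup>2)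
      - s\<^sup>2 * (s + d)\<^sup>2 * (d + (1 + d\<^sup>2) * s + 2 * d * s\<^sup>2) - d * (s + d) ^ 3 * (s + d + d * s\<^sup>2)" for s
    by (simp add: P_def A_def B_def C_def power2_eq_square power3_eq_cube algebra_simps)
  have "P = 0"
  proof (rule ccontr)
    assume "P \<noteq> 0"
    then have "finite {s. poly P s = 0}" by (rule poly_roots_finite)
    moreover have "{ell d<..} \<subseteq> {s. poly P s = 0}"
      using seventh_iterate_diagonal[OF d _ all] ell_root(1)[OF d] by (auto simp: ev)
    ultimately have "finite {ell d<..}" using finite_subset by blast
    then show False by (simp add: infinite_Ioi)
  qed
  then have P: "poly P 0 = 0" "poly P 1 = 0" by simp_all
  from P(1) have "d ^ 3 * (1 - d\<^sup>2) = 0" unfolding ev by (simp add: power2_eq_square power3_eq_cube algebra_simps)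
  then have "d\<^sup>2 = 1" using d by simp
  then have "d = 1" using d by (simp add: power2_eq_1_iff)
  with P(2) show False unfolding ev by simp
qed

text \<open>By the limit at infinity the ratio could only be \<open>4 / 3\<close>, for which seven shifts make two full periods on every
curve.\<close>

lemma quarter_ratio_not_constant:
  assumes d: "d > 0" and pq: "ell d < p" "p < q"
    and eq: "\<And>s. p < s \<Longrightarrow> s < q \<Longrightarrow> quarter_neg d s = c * quarter_pos d s"
  shows False
proof -
  have all: "quarter_neg d s = c * quarter_pos d s" if "s > ell d" for s
    by (rule quarter_ratio_propagates[OF d pq eq that])
  have c: "c = 4 / 3" by (rule quarter_ratio_limit[OF d all])
  show False
  proof (rule not_seven_periodic[OF d])
    fix s assume s: "s > ell d"
    interpret oval d s using d s by unfold_locales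
  obtain Z where cont: "continuous_on UNIV Z" and Z: "range Z = curve d K" "T > 0"
      "\<And>t. lyness d (Z t) = Z (t - quarter_neg d s)"
      "\<And>t u. Z t = Z u \<longleftrightarrow> (\<exists>m::int. t - u = of_int m * T)"
    by (rule lyness_translation) (rule that)
    have "(s, s) \<in> curve d K"
      using oval_in_curve[of "- pi / 2"] by (simp only: oval_special)
    then obtain t where t: "(s, s) = Z t" using Z(1) by (metis rangeE)
    have "(lyness d ^^ 7) (Z t) = Z (t - of_nat 7 * quarter_neg d s)"
      by (rule lyness_funpow) (rule Z(3))
    also have "\<dots> = Z t"
      \<comment> \<open>\<open>7 * a = 2 * (2 * (a + b))\<close> for \<open>a = 4 / 3 * b\<close>\<close>
      unfolding Z(4) using all[OF s] c by (intro exI[of _ "-2"]) simp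
    finally show "(lyness d ^^ 7) (s, s) = (s, s)" by (simp add: t)
  qed
qed

lemma rot_interval:
  assumes d: "d > 0" and pq: "ell d < p" "p < q"
  shows "\<exists>\<alpha> \<beta>. \<alpha> < \<beta> \<and> (\<forall>\<theta>. \<alpha> \<le> \<theta> \<and> \<theta> \<le> \<beta> \<longrightarrow> (\<exists>s. p < s \<and> s < q \<and> rotation_number d s = \<theta>))"
proof -
  have pos: "quarter_neg d s > 0" "quarter_pos d s > 0" if "s > ell d" for s
    using oval.quarters_pos[of d s] d that by (auto simp: oval_def)
  have sum: "quarter_neg d s + quarter_pos d s \<noteq> 0" if "s > ell d" for s
    using pos[OF that] by linarith
  have cont: "continuous_on {ell d<..} (rotation_number d)"
    unfolding rotation_number_def[abs_def] using sum by (intro continuous_intros continuous_quarter d) auto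
  have "\<exists>a b. a \<in> {p<..<q} \<and> b \<in> {p<..<q} \<and> rotation_number d a \<noteq> rotation_number d b"
  proof (rule ccontr)
    assume H: "\<nexists>a b. a \<in> {p<..<q} \<and> b \<in> {p<..<q} \<and> rotation_number d a \<noteq> rotation_number d b"
    define \<theta> where "\<theta> = rotation_number d ((p + q) / 2)"
    have \<theta>: "rotation_number d s = \<theta>" if "p < s" "s < q" for s
    proof -
      have "(p + q) / 2 \<in> {p<..<q}" using pq by auto
      then show ?thesis using H that unfolding \<theta>_def by (metis greaterThanLessThan_iff)
    qed
    \<comment> \<open>\<open>a / (a + b) = \<theta>\<close> means \<open>a = \<theta> / (1 - \<theta>) * b\<close>.\<close>
    show False
    proof (rule quarter_ratio_not_constant[OF d pq, of "\<theta> / (1 - \<theta>)"])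
      fix s assume s: "p < s" "s < q"
      then have "ell d < s" using pq by simp
      note ps = pos[OF this]
      have "\<theta> = quarter_neg d s / (quarter_neg d s + quarter_pos d s)" using \<theta>[OF s] by (simp add: rotation_number_def)
      moreover from this have "1 - \<theta> = quarter_pos d s / (quarter_neg d s + quarter_pos d s)"
        using ps by (simp add: field_simps)
      ultimately show "quarter_neg d s = \<theta> / (1 - \<theta>) * quarter_pos d s" using ps by simp
    qed
  qed
  then obtain a b where ab: "a \<in> {p<..<q}" "b \<in> {p<..<q}" "rotation_number d a < rotation_number d b"
    by (metis linorder_neqE_linordered_idom)
  have conn: "connected (rotation_number d ` {p<..<q})"
    using pq by (intro connected_continuous_image continuous_on_subset[OF cont]) auto
  show ?thesis
  proof (rule exI[of _ "rotation_number d a"], rule exI[of _ "rotation_number d b"], intro conjI allI impI)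
    show "rotation_number d a < rotation_number d b" by fact
    fix \<theta> assume "rotation_number d a \<le> \<theta> \<and> \<theta> \<le> rotation_number d b"
    then have "\<theta> \<in> rotation_number d ` {p<..<q}"
      using connectedD_interval[OF conn, of "rotation_number d a" "rotation_number d b" \<theta>] ab by auto
    then show "\<exists>s. p < s \<and> s < q \<and> rotation_number d s = \<theta>" by auto
  qed
qed

lemma rot_dense:
  assumes d: "d > 0" and pq: "ell d < p" "p < q"
  shows "\<exists>s. p < s \<and> s < q \<and> rotation_number d s \<in> \<rat>" "\<exists>s. p < s \<and> s < q \<and> rotation_number d s \<notin> \<rat>"
proof -
  obtain \<alpha> \<beta> where ab: "\<alpha> < \<beta>" "\<And>\<theta>. \<alpha> \<le> \<theta> \<Longrightarrow> \<theta> \<le> \<beta> \<Longrightarrow> \<exists>s. p < s \<and> s < q \<and> rotation_number d s = \<theta>"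
    using rot_interval[OF d pq] by blast
  obtain x where "x \<in> \<rat>" "\<alpha> < x" "x < \<beta>" using Rats_dense_in_real[OF ab(1)] by blast
  then show "\<exists>s. p < s \<and> s < q \<and> rotation_number d s \<in> \<rat>" using ab(2)[of x] by auto
  have "uncountable {\<alpha><..<\<beta>}" using ab(1) by (simp add: uncountable_open_interval)
  then have "\<not> {\<alpha><..<\<beta>} \<subseteq> \<rat>" using countable_rat countable_subset by blast
  then obtain y where "y \<in> {\<alpha><..<\<beta>}" "y \<notin> \<rat>" by blast
  then show "\<exists>s. p < s \<and> s < q \<and> rotation_number d s \<notin> \<rat>" using ab(2)[of y] by auto
qed

section \<open>Level curves fill the punctured quadrant\<close>

lemma level_ell:
  assumes "d > 0"
  shows "level d (ell d) = K_min d"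
proof -
  note r = ell_root[OF assms]
  have "d / (ell d)\<^sup>2 = (ell d ^ 3 - ell d) / (ell d)\<^sup>2" using r by simp
  also have "\<dots> = ell d - 1 / ell d"
    using r(1) by (simp add: field_simps power2_eq_square power3_eq_cube)
  finally show ?thesis by (simp add: level_def K_min_def)
qed

lemma curve_level_exists:
  assumes "d > 0" "K > K_min d"
  shows "\<exists>s > ell d. level d s = K"
proof -
  note r = ell_root[OF assms(1)]
  define b where "b = max (ell d) K"
  have b: "b > 0" "ell d \<le> b" "K \<le> b" using r by (auto simp: b_def)
  have "2 * b + 2 / b + d / b\<^sup>2 \<ge> 2 * b + 0 + 0"
    using assms(1) b(1) by (intro add_mono) auto
  then have "level d b \<ge> K" using b by (simp add: level_def)
  moreover have "continuous_on {ell d..b} (level d)"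
    using r(1) unfolding level_def[abs_def] by (auto intro!: continuous_intros)
  ultimately obtain s where s: "ell d \<le> s" "level d s = K"
    using IVT'[of "level d" "ell d" K b] level_ell assms b by auto
  then have "s \<noteq> ell d" using level_ell assms by auto
  with s show ?thesis by (intro exI[of _ s]) auto
qed

text \<open>The difference of the levels has the factor \<open>(s - ell d)\<^sup>2\<close>, since \<open>ell d\<close> is the critical point of the
level.\<close>

lemma level_gt_min:
  assumes d: "d > 0" and s: "s > 0" "s \<noteq> ell d"
  shows "level d s > K_min d"
proof -
  define l where "l = ell d"
  have l: "l > 0" "l ^ 3 - l - d = 0" using ell_root[OF d] by (auto simp: l_def)
  have L: "K_min d = level d l" using level_ell[OF d] by (simp add: l_def)
  have D: "d = l ^ 3 - l" using l by simp
  have "(level d s - level d l) * (s\<^sup>2 * l\<^sup>2) = (s - l)\<^sup>2 * (2 * s * l\<^sup>2 + l * (l\<^sup>2 - 1))"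
  proof -
    have m: "level d x * x\<^sup>2 = 2 * x ^ 3 + 2 * x + d" if "x > 0" for x
      using that by (simp add: level_def distrib_right power2_eq_square power3_eq_cube)
    show ?thesis using m[OF s(1)] m[OF l(1)] D by algebra
  qed
  moreover have "l * (l\<^sup>2 - 1) = d" by (simp add: D power2_eq_square power3_eq_cube algebra_simps)
  then have "2 * s * l\<^sup>2 + l * (l\<^sup>2 - 1) > 0" using s l d by (simp add: add_pos_pos)
  moreover have "(s - l)\<^sup>2 > 0" using s by (simp add: l_def)
  ultimately have "(level d s - level d l) * (s\<^sup>2 * l\<^sup>2) > 0" by simp
  moreover have "s\<^sup>2 * l\<^sup>2 > 0" using s l by simp
  ultimately have "level d s - level d l > 0" by (rule zero_less_mult_pos2)
  then show ?thesis using L by simp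
qed

text \<open>The arithmetic-geometric mean inequality reduces the minimisation of \<open>G\<close> to the diagonal.\<close>

lemma G_ge_level:
  assumes d: "d > 0" and xy: "x > 0" "y > 0"
  shows "G d (x, y) \<ge> level d (sqrt (x * y))" "x \<noteq> y \<Longrightarrow> G d (x, y) > level d (sqrt (x * y))"
proof -
  define r where "r = sqrt (x * y)"
  have r: "r > 0" "r\<^sup>2 = x * y" using xy by (auto simp: r_def)
  have "G d (x, y) - level d r = (x + y - 2 * r) * (1 + 1 / r\<^sup>2)"
  proof -
    have "1 / x + 1 / y = (x + y) / r\<^sup>2" using xy by (simp add: r(2) field_simps)
    moreover have "2 / r = 2 * r / r\<^sup>2" using r(1) by (simp add: power2_eq_square)
    ultimately show ?thesis unfolding G_def level_def using r(2)
      by (simp add: algebra_simps add_divide_distrib diff_divide_distrib)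
  qed
  moreover have "1 + 1 / r\<^sup>2 > 0" using r(1) by (intro add_pos_pos) auto
  moreover have sq: "x + y - 2 * r = (sqrt x - sqrt y)\<^sup>2"
    using xy by (simp add: r_def power2_diff real_sqrt_mult)
  ultimately show "G d (x, y) \<ge> level d (sqrt (x * y))"
    unfolding r_def by (metis diff_ge_0_iff_ge less_imp_le mult_nonneg_nonneg zero_le_power2)
  show "G d (x, y) > level d (sqrt (x * y))" if "x \<noteq> y"
  proof -
    have "(sqrt x - sqrt y)\<^sup>2 > 0" using that by simp
    then have "G d (x, y) - level d r > 0"
      using \<open>G d (x, y) - level d r = _\<close> \<open>1 + 1 / r\<^sup>2 > 0\<close> sq by simp
    then show ?thesis by (simp add: r_def)
  qed
qed

lemma G_gt_min_iff:
  assumes d: "d > 0" and p: "p \<in> quadrant"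
  shows "G d p > K_min d \<longleftrightarrow> p \<noteq> L d"
proof
  have "G d (L d) = K_min d"
    using level_ell[OF d] by (simp add: L_def G_def level_def power2_eq_square)
  then show "p \<noteq> L d" if "G d p > K_min d" using that by auto
  assume ne: "p \<noteq> L d"
  obtain x y where xy: "p = (x, y)" "x > 0" "y > 0" using p by (cases p) (auto simp: quadrant_def)
  show "G d p > K_min d"
  proof (cases "sqrt (x * y) = ell d")
    case True
    have "x \<noteq> y"
    proof
      assume "x = y"
      then have "x = ell d" using True xy by simp
      with \<open>x = y\<close> ne xy show False by (simp add: L_def)
    qed
    then have "G d p > level d (ell d)" using G_ge_level(2)[OF d xy(2,3)] True xy by simp
    then show ?thesis using level_ell[OF d] by simp
  next
    case False
    then have "level d (sqrt (x * y)) > K_min d" using xy by (intro level_gt_min d) auto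
    then show ?thesis using G_ge_level(1)[OF d xy(2,3)] xy by simp
  qed
qed

text \<open>Near a given point, take the point with the same parameter \<open>\<psi>\<close> on a neighbouring curve.\<close>

lemma dense_by_rotation:
  assumes d: "d > 0"
    and Q: "\<And>p q. ell d < p \<Longrightarrow> p < q \<Longrightarrow> \<exists>s. p < s \<and> s < q \<and> Q (rotation_number d s)"
    and sub: "S \<subseteq> quadrant - {L d}"
    and mem: "\<And>s x. s > ell d \<Longrightarrow> Q (rotation_number d s) \<Longrightarrow> x \<in> curve d (level d s) \<Longrightarrow> x \<in> S"
  shows "dense_subset S (quadrant - {L d})"
  unfolding dense_subset_def
proof (rule conjI[OF sub], rule subsetI)
  fix x assume x: "x \<in> quadrant - {L d}"
  then have "G d x > K_min d" using G_gt_min_iff[OF d] by auto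
  then obtain s where s: "s > ell d" "level d s = G d x" using curve_level_exists[OF d] by blast
  interpret oval d s using d s by unfold_locales
  have "x \<in> curve d K" using x s by (auto simp: curve_def)
  then obtain \<psi> where \<psi>: "x = (oval_x d s \<psi>, oval_y d s \<psi>)"
    using oval_surj[of "fst x" "snd x"] by (metis prod.collapse)
  have "isCont (\<lambda>s. (oval_x d s \<psi>, oval_y d s \<psi>)) s"
    using s_pos disc_den_pos(2)[of \<psi>]
    unfolding oval_x_def oval_y_def den_def lin_coeff_def disc_def excess_def half_gap_def
    by (auto intro!: continuous_intros)
  show "x \<in> closure S"
    unfolding closure_approachable
  proof (intro allI impI)
    fix \<epsilon> :: real assume "\<epsilon> > 0"
    then obtain \<delta> where \<delta>: "\<delta> > 0"
      "\<And>s'. dist s' s < \<delta> \<Longrightarrow> dist (oval_x d s' \<psi>, oval_y d s' \<psi>) x < \<epsilon>"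
      using \<open>isCont _ s\<close> unfolding continuous_at_eps_delta \<psi> by blast
    obtain s' where s': "s < s'" "s' < s + \<delta>" "Q (rotation_number d s')" using Q[of s "s + \<delta>"] s \<delta> by auto
    then interpret s': oval d s' using d s by unfold_locales auto
    have "(oval_x d s' \<psi>, oval_y d s' \<psi>) \<in> S"
      using mem[OF s'.s_gt s'(3) s'.oval_in_curve] .
    moreover have "dist (oval_x d s' \<psi>, oval_y d s' \<psi>) x < \<epsilon>"
      using s' by (intro \<delta>(2)) (auto simp: dist_real_def)
    ultimately show "\<exists>y\<in>S. dist y x < \<epsilon>" by blast
  qed
qed

section \<open>Reduced fractions in an interval\<close>

text \<open>Legendre's sieve. Adding a prime \<open>p\<close> removes the multiples of \<open>p\<close>, whose count is a sieved
count for the interval shrunk by \<open>p\<close>; so the error at most doubles.\<close>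

lemma sieve_interval_count:
  fixes P :: "nat set" and u v :: real
  assumes "finite P" "\<forall>p\<in>P. prime p" "u \<le> v"
  shows "\<bar>real (card {x::int. u < of_int x \<and> of_int x \<le> v \<and> (\<forall>p\<in>P. \<not> int p dvd x)})
           - (v - u) * (\<Prod>p\<in>P. 1 - 1 / real p)\<bar> \<le> 2 ^ card P"
  using assms
proof (induction P arbitrary: u v rule: finite_induct)
  case empty
  have "{x::int. u < of_int x \<and> of_int x \<le> v} = {\<lfloor>u\<rfloor><..\<lfloor>v\<rfloor>}"
    by (auto simp: floor_less_iff le_floor_iff)
  moreover have "\<lfloor>u\<rfloor> \<le> \<lfloor>v\<rfloor>"
    using empty by (simp add: floor_mono)
  ultimately have "real (card {x::int. u < of_int x \<and> of_int x \<le> v}) = of_int \<lfloor>v\<rfloor> - of_int \<lfloor>u\<rfloor>"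
    by simp
  then show ?case
    using floor_correct[of u] floor_correct[of v] by (simp add: abs_le_iff) linarith
next
  case (insert p P)
  define S where "S u v = {x::int. u < of_int x \<and> of_int x \<le> v \<and> (\<forall>q\<in>P. \<not> int q dvd x)}" for u v :: real
  have p: "prime p" "p > 0" and P: "\<forall>q\<in>P. prime q"
    using insert.prems prime_gt_0_nat by auto
  have fin: "finite (S u v)" for u v
  proof (rule finite_subset)
    show "S u v \<subseteq> {\<lfloor>u\<rfloor>..\<lfloor>v\<rfloor>}"
      by (auto simp: S_def le_floor_iff floor_le_iff)
  qed simp
  have sub: "(\<lambda>y. int p * y) ` S (u / p) (v / p) \<subseteq> S u v"
  proof
    fix x assume "x \<in> (\<lambda>y. int p * y) ` S (u / p) (v / p)"
    then obtain y where y: "y \<in> S (u / p) (v / p)" "x = int p * y" by auto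
    have "\<not> int q dvd x" if q: "q \<in> P" for q
    proof
      assume "int q dvd x"
      then have "int q dvd int p \<or> int q dvd y"
        using P q y(2) by (metis of_nat_dvd_iff prime_dvd_mult_iff prime_int_nat_transfer nat_int prime_nat_int_transfer)
      moreover have "\<not> int q dvd y" using y q by (auto simp: S_def)
      moreover have "\<not> int q dvd int p"
        using p P q insert.hyps by (metis int_dvd_int_iff primes_dvd_imp_eq)
      ultimately show False by blast
    qed
    then show "x \<in> S u v"
      using y p by (auto simp: S_def field_simps)
  qed
  have "{x::int. u < of_int x \<and> of_int x \<le> v \<and> (\<forall>q\<in>insert p P. \<not> int q dvd x)}
      = S u v - (\<lambda>y. int p * y) ` S (u / p) (v / p)"
  proof -
    have "x \<in> (\<lambda>y. int p * y) ` S (u / p) (v / p)" if "x \<in> S u v" "int p dvd x" for x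
    proof -
      from that(2) obtain y where "x = int p * y" by auto
      with that(1) p have "y \<in> S (u / p) (v / p)" by (auto simp: S_def field_simps)
      with \<open>x = int p * y\<close> show ?thesis by auto
    qed
    then show ?thesis by (auto simp: S_def)
  qed
  moreover have "card ((\<lambda>y. int p * y) ` S (u / p) (v / p)) = card (S (u / p) (v / p))"
    using p by (intro card_image) (auto simp: inj_on_def)
  ultimately have card: "real (card {x::int. u < of_int x \<and> of_int x \<le> v \<and> (\<forall>q\<in>insert p P. \<not> int q dvd x)})
      = real (card (S u v)) - real (card (S (u / p) (v / p)))"
    using sub fin card_mono[OF fin sub] by (simp add: card_Diff_subset finite_subset of_nat_diff)
  have "\<bar>real (card (S u v)) - (v - u) * (\<Prod>p\<in>P. 1 - 1 / real p)\<bar> \<le> 2 ^ card P"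
    unfolding S_def using insert.IH[OF P insert.prems(2)] .
  moreover have "u / p \<le> v / p"
    using insert.prems p by (simp add: divide_right_mono)
  then have "\<bar>real (card (S (u / p) (v / p))) - (v / p - u / p) * (\<Prod>p\<in>P. 1 - 1 / real p)\<bar> \<le> 2 ^ card P"
    unfolding S_def by (rule insert.IH[OF P])
  moreover have "(v - u) * (\<Prod>p\<in>insert p P. 1 - 1 / real p)
      = (v - u) * (\<Prod>p\<in>P. 1 - 1 / real p) - (v / p - u / p) * (\<Prod>p\<in>P. 1 - 1 / real p)"
    using insert.hyps by (simp add: algebra_simps diff_divide_distrib)
  ultimately show ?case
    unfolding card using insert.hyps by simp linarith
qed

text \<open>For squarefree \<open>q\<close> with \<open>k\<close> prime factors these are the factors of \<open>\<phi>(q) / (2\<^sup>k * sqrt q)\<close>, the quotient of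
the main term and the error term of the sieve, divided by \<open>sqrt q\<close>. Only the primes 2, 3 and 5 contribute less than 1.\<close>

lemma prod_prime_ratio_ge:
  fixes P :: "nat set"
  assumes "finite P" "\<forall>p\<in>P. prime p"
  shows "(\<Prod>p\<in>P. (real p - 1) / (2 * sqrt p)) \<ge> 1 / 27"
proof -
  define g :: "nat \<Rightarrow> real" where "g p = (if p \<in> {2,3,5} then 1/3 else 1)" for p
  have ge: "0 \<le> g p \<and> g p \<le> (real p - 1) / (2 * sqrt p)" if "p \<in> P" for p
  proof (cases "p < 6")
    case True
    then have "p \<in> {2,3,4,5}" using assms that prime_ge_2_nat[of p] by fastforce
    moreover have "\<not> prime (4::nat)" using prime_product[of 2 "2::nat"] by auto
    ultimately have "p = 2 \<or> p = 3 \<or> p = 5" using assms that by auto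
    moreover have "sqrt 2 \<le> 3/2" "sqrt 3 \<le> 3" "sqrt 5 \<le> 6"
      by (rule real_le_lsqrt; simp add: power2_eq_square)+
    ultimately show ?thesis by (auto simp: g_def field_simps)
  next
    case False
    have "2 * sqrt p \<le> real p - 1"
    proof (rule power2_le_imp_le)
      have "0 \<le> real p * (real p - 6)" using False by simp
      then show "(2 * sqrt (real p))\<^sup>2 \<le> (real p - 1)\<^sup>2"
        by (simp add: power_mult_distrib) (simp add: power2_eq_square algebra_simps)
    qed (use False in auto)
    with False show ?thesis by (auto simp: g_def)
  qed
  have "(\<Prod>p\<in>P. g p) = (\<Prod>p\<in>P \<inter> {2,3,5}. 1/3)"
    unfolding g_def by (simp only: prod.inter_restrict[OF assms(1)])
  also have "\<dots> = (1/3) ^ card (P \<inter> {2,3,5})" by simp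
  also have "\<dots> \<ge> (1/3::real) ^ 3"
  proof (rule power_decreasing)
    have "card (P \<inter> {2,3,5}) \<le> card {2,3,5::nat}" by (intro card_mono) auto
    then show "card (P \<inter> {2,3,5}) \<le> 3" by simp
  qed auto
  finally have "1/27 \<le> (\<Prod>p\<in>P. g p)" by (simp add: power3_eq_cube)
  also have "\<dots> \<le> (\<Prod>p\<in>P. (real p - 1) / (2 * sqrt p))"
    using ge by (intro prod_mono) auto
  finally show ?thesis .
qed

text \<open>The main term of the sieve exceeds its error term \<open>2\<^sup>k\<close> by a factor of order \<open>sqrt q\<close>.\<close>

lemma eventually_coprime_numerator:
  fixes \<alpha> \<beta> :: real
  assumes "\<alpha> < \<beta>"
  shows "\<exists>N>0. \<forall>q\<ge>N. \<exists>j::int. coprime j (int q) \<and> \<alpha> < of_int j / real q \<and> of_int j / real q < \<beta>"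
proof -
  \<comment> \<open>The sieve counts half-open intervals, so the upper half of the range is kept as a margin.\<close>
  define \<delta> where "\<delta> = (\<beta> - \<alpha>) / 2"
  have \<delta>: "\<delta> > 0" using assms by (simp add: \<delta>_def)
  have "\<beta> = \<alpha> + 2 * \<delta>" by (simp add: \<delta>_def field_simps)
  define N where "N = nat \<lceil>(27 / \<delta>)\<^sup>2\<rceil> + 1"
  show ?thesis
  proof (intro exI[of _ N] conjI allI impI)
    show "N > 0" by (simp add: N_def)
    fix q assume "N \<le> q"
    then have q: "(27 / \<delta>)\<^sup>2 < real q" "q > 0" unfolding N_def by linarith+
    define P where "P = prime_factors q"
    have P: "finite P" "\<forall>p\<in>P. prime p" by (auto simp: P_def)
    have Ppos: "real p > 0" if "p \<in> P" for p using P that prime_gt_0_nat by auto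
    have "(\<Prod>p\<in>P. p) dvd q"
    proof -
      have "(\<Prod>p\<in>P. p) dvd (\<Prod>p\<in>P. p ^ multiplicity p q)"
        unfolding P_def by (intro prod_dvd_prod dvd_power) (auto simp: prime_factors_multiplicity)
      also have "\<dots> = q" using q prod_prime_factors[of q] by (simp add: P_def)
      finally show ?thesis .
    qed
    then have "(\<Prod>p\<in>P. p) \<le> q" using q by (simp add: dvd_imp_le)
    then have "real (\<Prod>p\<in>P. p) \<le> real q" using of_nat_le_iff by blast
    then have prod_le: "(\<Prod>p\<in>P. real p) \<le> real q" by simp
    let ?u = "\<alpha> * q" and ?v = "(\<alpha> + \<delta>) * q"
    let ?S = "{x::int. ?u < of_int x \<and> of_int x \<le> ?v \<and> (\<forall>p\<in>P. \<not> int p dvd x)}"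
    have "(\<Prod>p\<in>P. 1 - 1 / real p) = 2 ^ card P * (\<Prod>p\<in>P. (real p - 1) / (2 * sqrt p)) / sqrt (\<Prod>p\<in>P. real p)"
    proof -
      have split: "(\<Prod>p\<in>P. 2 * f p / g p) = 2 ^ card P * (\<Prod>p\<in>P. f p) / (\<Prod>p\<in>P. g p)"
        for f g :: "nat \<Rightarrow> real"
        by (simp add: prod.distrib prod_dividef)
      have "(\<Prod>p\<in>P. 1 - 1 / real p) = (\<Prod>p\<in>P. 2 * ((real p - 1) / (2 * sqrt p)) / sqrt p)"
      proof (rule prod.cong)
        fix p assume "p \<in> P"
        have "2 * ((real p - 1) / (2 * sqrt p)) / sqrt p = (real p - 1) / (sqrt p * sqrt p)"
          by (simp add: divide_simps del: real_sqrt_mult_self)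
        also have "\<dots> = 1 - 1 / real p" using Ppos[OF \<open>p \<in> P\<close>] by (simp add: diff_divide_distrib)
        finally show "1 - 1 / real p = 2 * ((real p - 1) / (2 * sqrt p)) / sqrt p" by simp
      qed simp
      also have "\<dots> = 2 ^ card P * (\<Prod>p\<in>P. (real p - 1) / (2 * sqrt p)) / (\<Prod>p\<in>P. sqrt p)"
        by (rule split)
      also have "(\<Prod>p\<in>P. sqrt p) = sqrt (\<Prod>p\<in>P. real p)"
        using P(1) by (induction P rule: finite_induct) (simp_all add: real_sqrt_mult)
      finally show ?thesis .
    qed
    also have "\<dots> \<ge> 2 ^ card P * (1 / 27) / sqrt q"
      using prod_prime_ratio_ge[OF P] prod_le Ppos q
      by (intro frac_le mult_left_mono mult_nonneg_nonneg) (auto simp: prod_pos)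
    finally have "\<delta> * q * (2 ^ card P * (1 / 27) / sqrt q) \<le> \<delta> * q * (\<Prod>p\<in>P. 1 - 1 / real p)"
      using \<delta> by (intro mult_left_mono) auto
    moreover have "\<delta> * q * (2 ^ card P * (1 / 27) / sqrt q) = 2 ^ card P * (\<delta> * sqrt q / 27)"
      using q by (simp add: field_simps flip: power2_eq_square)
    moreover have "27 / \<delta> < sqrt q"
      using q by (simp add: real_less_rsqrt)
    then have "\<delta> * sqrt q / 27 > 1" using \<delta> by (simp add: field_simps)
    then have "2 ^ card P * (\<delta> * sqrt q / 27) > 2 ^ card P" by simp
    moreover have "\<bar>real (card ?S) - (?v - ?u) * (\<Prod>p\<in>P. 1 - 1 / real p)\<bar> \<le> 2 ^ card P"
      using \<delta> by (intro sieve_interval_count P) (auto intro!: mult_right_mono)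
    moreover have "?v - ?u = \<delta> * q" by (simp add: algebra_simps)
    ultimately have "real (card ?S) > 0" by (simp only:)
    then have "?S \<noteq> {}" by (metis card.empty less_irrefl of_nat_0)
    then obtain j where j: "?u < of_int j" "of_int j \<le> ?v" "\<forall>p\<in>P. \<not> int p dvd j" by blast
    have "coprime j (int q)"
    proof (rule ccontr)
      assume "\<not> coprime j (int q)"
      then have "\<bar>gcd j (int q)\<bar> \<noteq> 1" by (simp add: coprime_iff_gcd_eq_1)
      then obtain p where "prime p" "p dvd gcd j (int q)" using prime_factor_int by blast
      then have p: "prime p" "p dvd j" "p dvd int q" by auto
      then have "prime (nat p)" "int (nat p) = p" using prime_gt_0_int[of p] by auto
      then have "nat p dvd q" using p(3) by (metis int_dvd_int_iff)
      then have "nat p \<in> P" using \<open>prime (nat p)\<close> q by (simp add: P_def prime_factors_dvd)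
      with j(3) p \<open>int (nat p) = p\<close> show False by metis
    qed
    moreover have "\<alpha> < of_int j / real q" using j q by (simp add: field_simps)
    moreover have "of_int j / real q \<le> \<alpha> + \<delta>" using j q by (simp add: field_simps)
    then have "of_int j / real q < \<beta>" using \<delta> \<open>\<beta> = \<alpha> + 2 * \<delta>\<close> by linarith
    ultimately show "\<exists>j::int. coprime j (int q) \<and> \<alpha> < of_int j / real q \<and> of_int j / real q < \<beta>" by blast
  qed
qed

section \<open>Density and periods\<close>

theorem theorem15:
  fixes d :: real
  assumes "d > 0"
  shows "(\<exists>A B. A \<union> B = quadrant - {L d} \<and> A \<inter> B = {} \<and>
            dense_subset A (quadrant - {L d}) \<and> dense_subset B (quadrant - {L d}) \<and>
            union_of_curves d A \<and> union_of_curves d B \<and>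
            (\<forall>p\<in>A. periodic_point (F d) p) \<and>
            (\<forall>p\<in>B. dense_subset (forward_orbit (F d) p) (curve d (G d p))))
       \<and> (\<exists>N::nat. \<forall>q\<ge>N. \<exists>u v. positive_solution d u v \<and>
            minimal_seq_period (\<lambda>n. (u n, v n)) q)"
proof
  define A where "A = {p \<in> quadrant - {L d}. periodic_point (F d) p}"
  define B where "B = {p \<in> quadrant - {L d}. \<not> periodic_point (F d) p}"
  have oval: "oval d s" if "s > ell d" for s using that assms by unfold_locales
  have param: "\<exists>s>ell d. level d s = G d p \<and> p \<in> curve d (level d s)" if "p \<in> quadrant - {L d}" for p
    using that G_gt_min_iff[OF assms, of p] curve_level_exists[OF assms, of "G d p"]
    by (auto simp: curve_def)
  have curve_sub: "curve d (level d s) \<subseteq> quadrant - {L d}" if s: "s > ell d" for s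
  proof
    fix p assume p: "p \<in> curve d (level d s)"
    have "level d s > K_min d" using s ell_root[OF assms] by (intro level_gt_min assms) auto
    with p show "p \<in> quadrant - {L d}" using G_gt_min_iff[OF assms, of p] by (auto simp: curve_def)
  qed
  have unionc: "union_of_curves d {p \<in> quadrant - {L d}. periodic_point (F d) p = b}" (is "union_of_curves d ?S") for b
    unfolding union_of_curves_def
  proof (intro exI[of _ "G d ` ?S"] conjI)
    show "G d ` ?S \<subseteq> {K_min d<..}" using G_gt_min_iff[OF assms] by auto
    show "?S = (\<Union>K\<in>G d ` ?S. curve d K)"
    proof (intro equalityI subsetI)
      fix p assume "p \<in> ?S"
      moreover from this have "p \<in> curve d (G d p)" by (auto simp: curve_def)
      ultimately show "p \<in> (\<Union>K\<in>G d ` ?S. curve d K)" by blast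
    next
      fix p assume "p \<in> (\<Union>K\<in>G d ` ?S. curve d K)"
      then obtain p' where p': "p' \<in> ?S" "p \<in> curve d (G d p')" by auto
      then obtain s where s: "s > ell d" "level d s = G d p'" "p' \<in> curve d (level d s)" using param by blast
      have p: "p \<in> curve d (level d s)" using p' s by simp
      have "periodic_point (F d) p = periodic_point (F d) p'"
        using oval.rational_rotation_periodic[OF oval[OF s(1)]] p s(3) by simp
      then show "p \<in> ?S" using p' curve_sub[OF s(1)] p by auto
    qed
  qed
  have "dense_subset A (quadrant - {L d})"
  proof (rule dense_by_rotation[OF assms, where Q = "\<lambda>\<theta>. \<theta> \<in> \<rat>"])
    show "x \<in> A" if "s > ell d" "rotation_number d s \<in> \<rat>" "x \<in> curve d (level d s)" for s x
      using that curve_sub oval.rational_rotation_periodic[OF oval] by (auto simp: A_def)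
  qed (use rot_dense(1)[OF assms] in \<open>auto simp: A_def\<close>)
  moreover have "dense_subset B (quadrant - {L d})"
  proof (rule dense_by_rotation[OF assms, where Q = "\<lambda>\<theta>. \<theta> \<notin> \<rat>"])
    show "x \<in> B" if "s > ell d" "rotation_number d s \<notin> \<rat>" "x \<in> curve d (level d s)" for s x
      using that curve_sub oval.rational_rotation_periodic[OF oval] by (auto simp: B_def)
  qed (use rot_dense(2)[OF assms] in \<open>auto simp: B_def\<close>)
  moreover have "dense_subset (forward_orbit (F d) p) (curve d (G d p))" if "p \<in> B" for p
  proof -
    have "p \<in> quadrant - {L d}" using that by (simp add: B_def)
    from param[OF this] obtain s where s: "s > ell d" "level d s = G d p" "p \<in> curve d (level d s)"
      by blast
    then have "rotation_number d s \<notin> \<rat>"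
      using that oval.rational_rotation_periodic[OF oval] by (auto simp: B_def)
    then show ?thesis
      using oval.irrational_rotation_dense[OF oval[OF s(1)] s(3)] s(2) by simp
  qed
  moreover have "union_of_curves d A" "union_of_curves d B"
    using unionc[of True] unionc[of False] by (simp_all add: A_def B_def)
  ultimately show "\<exists>A B. A \<union> B = quadrant - {L d} \<and> A \<inter> B = {} \<and>
            dense_subset A (quadrant - {L d}) \<and> dense_subset B (quadrant - {L d}) \<and>
            union_of_curves d A \<and> union_of_curves d B \<and>
            (\<forall>p\<in>A. periodic_point (F d) p) \<and>
            (\<forall>p\<in>B. dense_subset (forward_orbit (F d) p) (curve d (G d p)))"
    by (intro exI[of _ A] exI[of _ B]) (auto simp: A_def B_def)
next
  obtain \<alpha> \<beta> where ab: "\<alpha> < \<beta>"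
    "\<And>\<theta>. \<alpha> \<le> \<theta> \<Longrightarrow> \<theta> \<le> \<beta> \<Longrightarrow> \<exists>s. ell d + 1 < s \<and> s < ell d + 2 \<and> rotation_number d s = \<theta>"
    using rot_interval[OF assms, of "ell d + 1" "ell d + 2"] by auto
  obtain N where N: "N > 0" "\<And>q. q \<ge> N \<Longrightarrow>
      \<exists>j::int. coprime j (int q) \<and> \<alpha> < of_int j / real q \<and> of_int j / real q < \<beta>"
    using eventually_coprime_numerator[OF ab(1)] by blast
  show "\<exists>N::nat. \<forall>q\<ge>N. \<exists>u v. positive_solution d u v \<and> minimal_seq_period (\<lambda>n. (u n, v n)) q"
  proof (intro exI[of _ N] allI impI)
    fix q assume q: "N \<le> q"
    then have "q > 0" using N(1) by simp
    obtain j :: int where j: "coprime j (int q)" "\<alpha> < of_int j / real q" "of_int j / real q < \<beta>"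
      using N(2)[OF q] by blast
    obtain s where s: "ell d + 1 < s" "rotation_number d s = of_int j / real q"
      using ab(2)[of "of_int j / real q"] j by auto
    then interpret oval d s using assms by unfold_locales auto
    define p where "p = (oval_x d s 0, oval_y d s 0)"
    have p: "p \<in> curve d K" by (simp add: p_def oval_in_curve)
    have per: "(F d ^^ n) p = p \<longleftrightarrow> q dvd n" for n
      using exact_period[OF p s(2) j(1) \<open>q > 0\<close>] .
    define u where "u n = fst ((F d ^^ n) p)" for n
    define v where "v n = snd ((F d ^^ n) p)" for n
    have uv: "(u n, v n) = (F d ^^ n) p" for n by (simp add: u_def v_def)
    have "positive_solution d u v"
      unfolding positive_solution_iff[OF assms] using p uv by (auto simp: curve_def u_def v_def)
    moreover have "minimal_seq_period (\<lambda>n. (u n, v n)) q"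
      unfolding minimal_seq_period_def seq_period_def uv
    proof (intro conjI allI impI)
      show "q > 0" by fact
      show "(F d ^^ (n + q)) p = (F d ^^ n) p" for n
        using per[of q] by (simp add: funpow_add)
      fix r assume "r > 0 \<and> (\<forall>n. (F d ^^ (n + r)) p = (F d ^^ n) p)"
      then have "r > 0" "(F d ^^ (0 + r)) p = (F d ^^ 0) p" by blast+
      then show "q \<le> r" using per[of r] by (auto intro: dvd_imp_le)
    qed
    ultimately show "\<exists>u v. positive_solution d u v \<and> minimal_seq_period (\<lambda>n. (u n, v n)) q" by blast
  qed
qed

end
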